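(* Let $\Sigma^+_t=\mathrm{diag}(F^+_t)+A\,\mathrm{diag}(V^+_t)\,A'$ be the integrated covariance process described in the context, with $F=(F_t)_{t\ge0}$ and $V=(V_t)_{t\ge0}$ following Ornstein–Uhlenbeck processes having deterministic initial values $F_0$ and $V_0$ and independent Inverse Gaussian subordinators as background driving Lévy processes. Denote by $\varphi_{\Sigma^+_t}$ its characteristic function, let $\theta=(\theta_{kj})_{k,j=1,2}$ be a $2\times2$ matrix and $\tilde\theta\in\mathbb{R}$. Then, for $\theta\neq0$, $$\varphi_{\Sigma^+_t}(\theta)=\exp\big(K_1^+(\theta)+K_2^+(\theta)\big),$$ with $$K_1^+(\theta)=i\sum_{l=1}^2\theta_{ll}\,\lambda_{F,l}^{-1}(1-e^{-\lambda_{F,l}t})F_0^{(l)}+\sum_{l=1}^2 I_F^{(l)}(\lambda_{F,l}t,\theta_{ll}),$$ $$K_2^+(\theta)=i\sum_{l=1}^2\mathrm{tr}(\theta AC_lA')\,\lambda_{V,l}^{-1}(1-e^{-\lambda_{V,l}t})V_0^{(l)}+\sum_{l=1}^2 I_V^{(l)}\big(\lambda_{V,l}t,\mathrm{tr}(\theta AC_lA')\big),$$ $$I_F^{(l)}(\lambda_{F,l}t,\tilde\theta)=-\frac{2a_{F,l}}{\sqrt{i\lambda_{F,l}}}\Big[-T_2^{F,l}(t,\tilde\theta)+\sqrt{i\lambda_{F,l}}\,b_{F,l}+\frac i2\,T_1^{F,l}(\tilde\theta)\,G^{F,l}(\tilde\theta)\Big]+\lambda_{F,l}a_{F,l}b_{F,l}t,$$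 $$I_V^{(l)}(\lambda_{V,l}t,\tilde\theta)=-\frac{2a_{V,l}}{\sqrt{i\lambda_{V,l}}}\Big[-T_2^{V,l}(t,\tilde\theta)+\sqrt{i\lambda_{V,l}}\,b_{V,l}+\frac i2\,T_1^{V,l}(\tilde\theta)\,G^{V,l}(\tilde\theta)\Big]+\lambda_{V,l}a_{V,l}b_{V,l}t,$$ and $$G^{F,l}(\tilde\theta)=\log\left(e^{-\lambda_{F,l}t}\,\frac{\big(T_1^{F,l}(\tilde\theta)+i\sqrt{i\lambda_{F,l}}\,b_{F,l}\big)^2}{\big(T_1^{F,l}(\tilde\theta)+i\,T_2^{F,l}(t,\tilde\theta)\big)^2}\right),$$ $$T_1^{F,l}(\tilde\theta)=\sqrt{-2\tilde\theta-i\lambda_{F,l}b_{F,l}^2},\qquad T_2^{F,l}(t,\tilde\theta)=\sqrt{2\tilde\theta(1-e^{-\lambda_{F,l}t})+i\lambda_{F,l}b_{F,l}^2}.$$ Analogous expressions for $T_1^{V,l}$, $T_2^{V,l}$ and $G^{V,l}$ are defined by replacing $F$ by $V$.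
   Context: Laws and expectations are under an equivalent martingale measure $\mathcal{Q}$, and $\varphi_{\Sigma^+_t}(\theta)=E_{\mathcal{Q}}[\exp(i\,\mathrm{tr}(\theta\Sigma^+_t))]$. For $l=1,2$, the processes $F=(F^{(1)},F^{(2)})$ and $V=(V^{(1)},V^{(2)})$ are given by $dF^{(l)}_t=-\lambda_{F,l}F^{(l)}_t\,dt+dZ^{(F,l)}_{\lambda_{F,l}t}$ and $dV^{(l)}_t=-\lambda_{V,l}V^{(l)}_t\,dt+dZ^{(V,l)}_{\lambda_{V,l}t}$ with $\lambda_{F,l}>0$, $\lambda_{V,l}>0$. The background driving Lévy processes $Z^{(F,l)}$, $Z^{(V,l)}$ are independent Inverse Gaussian subordinators with respective characteristic exponents $\Psi_{Z^{F,l}}(\vartheta)=-a_{F,l}\big(\sqrt{-2i\vartheta+b_{F,l}^2}-b_{F,l}\big)$ and $\Psi_{Z^{V,l}}(\vartheta)=-a_{V,l}\big(\sqrt{-2i\vartheta+b_{V,l}^2}-b_{V,l}\big)$, where $a_{F,l},b_{F,l},a_{V,l},b_{V,l}$ are the subordinators' parameters. $F^+_t=\int_0^tF_s\,ds$ and $V^+_t=\int_0^tV_s\,ds$ (componentwise). $A$ is a $2\times2$ deterministic orthonormal loading matrix and $A'$ its transpose. The covariance process is $\Sigma_t=\mathrm{diag}(F_t)+A\,\mathrm{diag}(V_t)A'$, $t\ge0$, and $\Sigma^+_t=\int_0^t\Sigma_s\,ds$, where $\mathrm{diag}(v)$ is the diagonal matrix with the components of the vector $v$ on its diagonal. $C_l$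 is the $2\times2$ matrix with a one in position $(l,l)$ and zeros elsewhere. The complex logarithm is defined by the principal value of the argument.
   Formalization: For θ ≠ 0 with some θ_ll = 0 or tr(θAC_lA') = 0, the stated G is log(0/0) and undefined; there I_F^{(l)} or I_V^{(l)} is taken to be its limit as the argument tends to 0 (which is 0). *)

theory Defs
  imports "HOL-Probability.Probability"
begin

section \<open>Levy processes and subordinators\<close>

text \<open>Processes are functions \<open>time \<Rightarrow> outcome \<Rightarrow> value\<close>; only times \<open>t \<ge> 0\<close> are relevant.\<close>

definition cadlag :: "(real \<Rightarrow> real) \<Rightarrow> bool" where
  "cadlag f \<longleftrightarrow> (\<forall>t\<ge>0. continuous (at_right t) f) \<and> (\<forall>t>0. \<exists>l. (f \<longlongrightarrow> l) (at_left t))"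

text \<open>Stochastic continuity is not listed separately: it follows from right-continuity of the
  paths at \<open>0\<close> and stationarity of the increments.\<close>

definition levy_process :: "'a measure \<Rightarrow> (real \<Rightarrow> 'a \<Rightarrow> real) \<Rightarrow> bool" where
  "levy_process M Z \<longleftrightarrow>
     (\<forall>t\<ge>0. Z t \<in> borel_measurable M) \<and>
     (AE \<omega> in M. Z 0 \<omega> = 0) \<and>
     (\<forall>(\<tau> :: nat \<Rightarrow> real) n. 0 \<le> \<tau> 0 \<and> mono \<tau> \<longrightarrow>
        prob_space.indep_vars M (\<lambda>_. borel) (\<lambda>i \<omega>. Z (\<tau> (Suc i)) \<omega> - Z (\<tau> i) \<omega>) {..<n}) \<and>
     (\<forall>s\<ge>0. \<forall>h\<ge>0. distr M borel (\<lambda>\<omega>. Z (s + h) \<omega> - Z s \<omega>) = distr M borel (Z h)) \<and>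
     (AE \<omega> in M. cadlag (\<lambda>t. Z t \<omega>))"

definition subordinator :: "'a measure \<Rightarrow> (real \<Rightarrow> 'a \<Rightarrow> real) \<Rightarrow> bool" where
  "subordinator M Z \<longleftrightarrow> levy_process M Z \<and> (AE \<omega> in M. mono_on {0..} (\<lambda>t. Z t \<omega>))"

definition characteristic_exponent ::
    "'a measure \<Rightarrow> (real \<Rightarrow> 'a \<Rightarrow> real) \<Rightarrow> (real \<Rightarrow> complex) \<Rightarrow> bool" where
  "characteristic_exponent M Z \<Psi> \<longleftrightarrow>
     (\<forall>t\<ge>0. \<forall>u. char (distr M borel (Z t)) u = exp (of_real t * \<Psi> u))"

definition ig_exponent :: "real \<Rightarrow> real \<Rightarrow> real \<Rightarrow> complex" where
  "ig_exponent a b u =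
     - of_real a * (csqrt (- 2 * \<i> * of_real u + (of_real b)\<^sup>2) - of_real b)"

definition ig_subordinator ::
    "'a measure \<Rightarrow> real \<Rightarrow> real \<Rightarrow> (real \<Rightarrow> 'a \<Rightarrow> real) \<Rightarrow> bool" where
  "ig_subordinator M a b Z \<longleftrightarrow>
     subordinator M Z \<and> characteristic_exponent M Z (ig_exponent a b)"

text \<open>Independence of whole processes: the path-valued random variables are independent with
  respect to the product \<open>\<sigma>\<close>-algebra.\<close>

definition independent_processes ::
    "'a measure \<Rightarrow> 'i set \<Rightarrow> ('i \<Rightarrow> real \<Rightarrow> 'a \<Rightarrow> real) \<Rightarrow> bool" where
  "independent_processes M I Z \<longleftrightarrow>
     prob_space.indep_vars M (\<lambda>_. \<Pi>\<^sub>M t\<in>{0..}. borel) (\<lambda>i \<omega>. \<lambda>t\<in>{0..}. Z i t \<omega>) I"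

section \<open>Ornstein--Uhlenbeck processes and the integrated covariance\<close>

text \<open>The equation \<open>dX\<^sub>t = - \<lambda> X\<^sub>t dt + dZ\<^bsub>\<lambda>t\<^esub>\<close> with deterministic initial value \<open>x\<^sub>0\<close>, in its
  integrated form. Almost surely the identity holds for all times at once. Joint measurability
  in time and outcome makes the time integrals of \<open>X\<close> random variables; it is automatic for
  processes all of whose paths are cadlag.\<close>

definition ou_process ::
    "'a measure \<Rightarrow> real \<Rightarrow> real \<Rightarrow> (real \<Rightarrow> 'a \<Rightarrow> real) \<Rightarrow> (real \<Rightarrow> 'a \<Rightarrow> real) \<Rightarrow> bool" where
  "ou_process M lam x0 Z X \<longleftrightarrow>
     (\<lambda>(t, \<omega>). X t \<omega>) \<in> borel_measurable (restrict_space borel {0..} \<Otimes>\<^sub>M M) \<and>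
     (AE \<omega> in M. \<forall>t\<ge>0.
        set_integrable lborel {0..t} (\<lambda>s. X s \<omega>) \<and>
        X t \<omega> = x0 - lam * (LINT s:{0..t}|lborel. X s \<omega>) + Z (lam * t) \<omega>)"

definition diag_matrix :: "'b::zero ^ 'n \<Rightarrow> 'b ^ 'n ^ 'n" where
  "diag_matrix v = (\<chi> i j. if i = j then v $ i else 0)"

definition unit_matrix :: "'n \<Rightarrow> real ^ 'n ^ 'n" where
  "unit_matrix l = (\<chi> i j. if i = l \<and> j = l then 1 else 0)"

definition covariance ::
    "real^2^2 \<Rightarrow> (real \<Rightarrow> 'a \<Rightarrow> real^2) \<Rightarrow> (real \<Rightarrow> 'a \<Rightarrow> real^2) \<Rightarrow> real \<Rightarrow> 'a \<Rightarrow> real^2^2" where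
  "covariance A F V t \<omega> = diag_matrix (F t \<omega>) + A ** diag_matrix (V t \<omega>) ** transpose A"

definition time_integral ::
    "(real \<Rightarrow> 'a \<Rightarrow> 'b) \<Rightarrow> real \<Rightarrow> 'a \<Rightarrow> 'b::{banach, second_countable_topology}" where
  "time_integral X t \<omega> = (LINT s:{0..t}|lborel. X s \<omega>)"

definition integrated_covariance ::
    "real^2^2 \<Rightarrow> (real \<Rightarrow> 'a \<Rightarrow> real^2) \<Rightarrow> (real \<Rightarrow> 'a \<Rightarrow> real^2) \<Rightarrow> real \<Rightarrow> 'a \<Rightarrow> real^2^2" where
  "integrated_covariance A F V = time_integral (covariance A F V)"

lemma set_integrable_vec:
  fixes f :: "real \<Rightarrow> real^'n"
  assumes "\<And>i. set_integrable lborel S (\<lambda>s. f s $ i)"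
  shows "set_integrable lborel S f"
proof -
  have "integrable lborel (\<lambda>s. \<Sum>i\<in>UNIV. (indicator S s *\<^sub>R (f s $ i)) *\<^sub>R (axis i 1 :: real^'n))"
    using assms unfolding set_integrable_def
    by (intro Bochner_Integration.integrable_sum integrable_scaleR_left) auto
  moreover have "(\<Sum>i\<in>UNIV. (indicator S s *\<^sub>R (f s $ i)) *\<^sub>R (axis i 1 :: real^'n))
      = indicator S s *\<^sub>R f s" for s
    by (simp add: vec_eq_iff axis_def if_distrib cong: if_cong)
  ultimately show ?thesis
    unfolding set_integrable_def by simp
qed

lemma time_integral_linear:
  fixes X :: "real \<Rightarrow> 'a \<Rightarrow> 'b::euclidean_space" and L :: "'b \<Rightarrow> 'c::euclidean_space"
  assumes "linear L" and "set_integrable lborel {0..t} (\<lambda>s. X s \<omega>)"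
  shows "set_integrable lborel {0..t} (\<lambda>s. L (X s \<omega>))"
    and "time_integral (\<lambda>s \<omega>. L (X s \<omega>)) t \<omega> = L (time_integral X t \<omega>)"
proof -
  interpret bounded_linear L
    using assms(1) by (rule linear_conv_bounded_linear[THEN iffD1])
  have *: "integrable lborel (\<lambda>s. indicator {0..t} s *\<^sub>R X s \<omega>)"
    using assms(2) unfolding set_integrable_def .
  show "set_integrable lborel {0..t} (\<lambda>s. L (X s \<omega>))"
    using integrable_bounded_linear[OF bounded_linear_axioms *]
    unfolding set_integrable_def by (simp add: scaleR)
  show "time_integral (\<lambda>s \<omega>. L (X s \<omega>)) t \<omega> = L (time_integral X t \<omega>)"
    using integral_bounded_linear[OF bounded_linear_axioms *]
    unfolding time_integral_def set_lebesgue_integral_def by (simp add: scaleR)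
qed

lemma linear_diag_matrix: "linear (diag_matrix :: real^'n \<Rightarrow> real^'n^'n)"
  by (rule linearI) (auto simp: diag_matrix_def vec_eq_iff)

lemma linear_conjugate_diag_matrix:
  "linear (\<lambda>v :: real^'n. A ** diag_matrix v ** transpose (A :: real^'n^'n))"
proof (rule linearI)
  fix v w :: "real^'n" and c :: real
  show "A ** diag_matrix (v + w) ** transpose A
      = A ** diag_matrix v ** transpose A + A ** diag_matrix w ** transpose A"
    by (simp add: linear_add[OF linear_diag_matrix] matrix_add_ldistrib)
       (simp add: matrix_matrix_mult_def vec_eq_iff sum.distrib distrib_right)
  show "A ** diag_matrix (c *\<^sub>R v) ** transpose A = c *\<^sub>R (A ** diag_matrix v ** transpose A)"
    by (simp add: linear_scale[OF linear_diag_matrix])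
       (simp add: matrix_matrix_mult_def vec_eq_iff sum_distrib_left sum_distrib_right mult_ac)
qed

text \<open>On every path along which \<open>F\<close> and \<open>V\<close> are integrable,
  \<open>\<Sigma>\<^sup>+\<^sub>t = diag (F\<^sup>+\<^sub>t) + A diag (V\<^sup>+\<^sub>t) A'\<close>.\<close>

lemma integrated_covariance_eq:
  assumes "\<And>l. set_integrable lborel {0..t} (\<lambda>s. F s \<omega> $ l)"
    and "\<And>l. set_integrable lborel {0..t} (\<lambda>s. V s \<omega> $ l)"
  shows "integrated_covariance A F V t \<omega> =
    diag_matrix (time_integral F t \<omega>) + A ** diag_matrix (time_integral V t \<omega>) ** transpose A"
proof -
  note F = time_integral_linear[where X = F, OF linear_diag_matrix
      set_integrable_vec[where f = "\<lambda>s. F s \<omega>", OF assms(1)]]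
  note V = time_integral_linear[where X = V, OF linear_conjugate_diag_matrix[of A]
      set_integrable_vec[where f = "\<lambda>s. V s \<omega>", OF assms(2)]]
  have "integrated_covariance A F V t \<omega> =
      time_integral (\<lambda>s \<omega>. diag_matrix (F s \<omega>)) t \<omega> +
      time_integral (\<lambda>s \<omega>. A ** diag_matrix (V s \<omega>) ** transpose A) t \<omega>"
    unfolding integrated_covariance_def time_integral_def covariance_def
    by (rule set_integral_add(2)[OF F(1) V(1)])
  then show ?thesis
    by (simp add: F(2) V(2))
qed

definition matrix_char :: "'a measure \<Rightarrow> ('a \<Rightarrow> real^'n^'n) \<Rightarrow> real^'n^'n \<Rightarrow> complex" where
  "matrix_char M X \<theta> = (CLINT \<omega>|M. iexp (trace (\<theta> ** X \<omega>)))"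

section \<open>The closed-form exponent\<close>

text \<open>The square root and the logarithm are the principal branches \<^const>\<open>csqrt\<close> and
  \<^const>\<open>Ln\<close>.\<close>

definition T1 :: "real \<Rightarrow> real \<Rightarrow> real \<Rightarrow> complex" where
  "T1 lam b x = csqrt (- 2 * of_real x - \<i> * of_real lam * (of_real b)\<^sup>2)"

definition T2 :: "real \<Rightarrow> real \<Rightarrow> real \<Rightarrow> real \<Rightarrow> complex" where
  "T2 lam b t x =
     csqrt (2 * of_real x * (1 - of_real (exp (- lam * t))) + \<i> * of_real lam * (of_real b)\<^sup>2)"

definition G :: "real \<Rightarrow> real \<Rightarrow> real \<Rightarrow> real \<Rightarrow> complex" where
  "G lam b t x =
     Ln (of_real (exp (- lam * t)) *
         ((T1 lam b x + \<i> * csqrt (\<i> * of_real lam) * of_real b)\<^sup>2 /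
          (T1 lam b x + \<i> * T2 lam b t x)\<^sup>2))"

definition I_formula :: "real \<Rightarrow> real \<Rightarrow> real \<Rightarrow> real \<Rightarrow> real \<Rightarrow> complex" where
  "I_formula lam a b t x =
     - (2 * of_real a / csqrt (\<i> * of_real lam)) *
       (- T2 lam b t x + csqrt (\<i> * of_real lam) * of_real b + \<i> / 2 * T1 lam b x * G lam b t x)
     + of_real lam * of_real a * of_real b * of_real t"

text \<open>At \<open>x = 0\<close> the quotient inside \<^const>\<open>G\<close> is \<open>0/0\<close>, so the formula has no meaning there.
  A nonzero matrix \<open>\<theta>\<close> can still have \<open>\<theta>\<^bsub>ll\<^esub> = 0\<close> or \<open>tr (\<theta> A C\<^sub>l A') = 0\<close>; for such
  arguments the formula is read as its limit (the singularity at \<open>0\<close> is removable).\<close>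

definition I_plus :: "real \<Rightarrow> real \<Rightarrow> real \<Rightarrow> real \<Rightarrow> real \<Rightarrow> complex" where
  "I_plus lam a b t x =
     (if x = 0 then Lim (at 0) (I_formula lam a b t) else I_formula lam a b t x)"

definition K1_plus ::
    "real^2 \<Rightarrow> real^2 \<Rightarrow> real^2 \<Rightarrow> real^2 \<Rightarrow> real \<Rightarrow> real^2^2 \<Rightarrow> complex" where
  "K1_plus lamF aF bF f0 t \<theta> =
     \<i> * (\<Sum>l\<in>UNIV. of_real (\<theta> $ l $ l * inverse (lamF $ l) * (1 - exp (- (lamF $ l) * t)) * f0 $ l))
     + (\<Sum>l\<in>UNIV. I_plus (lamF $ l) (aF $ l) (bF $ l) t (\<theta> $ l $ l))"

definition K2_plus ::
    "real^2^2 \<Rightarrow> real^2 \<Rightarrow> real^2 \<Rightarrow> real^2 \<Rightarrow> real^2 \<Rightarrow> real \<Rightarrow> real^2^2 \<Rightarrow> complex" where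
  "K2_plus A lamV aV bV v0 t \<theta> =
     \<i> * (\<Sum>l\<in>UNIV. of_real (trace (\<theta> ** A ** unit_matrix l ** transpose A) *
            inverse (lamV $ l) * (1 - exp (- (lamV $ l) * t)) * v0 $ l))
     + (\<Sum>l\<in>UNIV. I_plus (lamV $ l) (aV $ l) (bV $ l) t
          (trace (\<theta> ** A ** unit_matrix l ** transpose A)))"

end

theory Submission
  imports Defs
begin

text \<open>
  For one factor, multiplying the integrated equation by \<open>e\<^bsup>\<lambda>s\<^esup>\<close> gives
  \<open>X\<^sup>+\<^sub>t = \<lambda>\<^sup>-\<^sup>1 (1 - e\<^bsup>-\<lambda>t\<^esup>) x\<^sub>0 + \<integral>\<^sub>0\<^sup>t \<lambda>\<^sup>-\<^sup>1 (1 - e\<^bsup>-\<lambda>(t-s)\<^esup>) dZ\<^bsub>\<lambda>s\<^esub>\<close>, and the stochastic integral is a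
  pathwise limit of Riemann--Stieltjes sums because the paths of \<open>Z\<close> are monotone. These sums are
  functions of finitely many independent increments, so their characteristic functions at \<open>x\<close> are
  exponentials of Riemann sums for
  \<open>\<integral>\<^sub>0\<^sup>t \<lambda> \<Psi> (x \<lambda>\<^sup>-\<^sup>1 (1 - e\<^bsup>-\<lambda>r\<^esup>)) dr\<close>, and they are measurable with
  respect to the product \<open>\<sigma>\<close>-algebra on paths, so that independence of the four drivers passes to
  the limit.

  The closed form is the antiderivative obtained by substituting \<open>S = T\<^sub>2(r)\<close>. All square roots
  \<open>\<kappa> = i T\<^sub>1\<close>, \<open>S\<close> and \<open>\<surd>(i\<lambda>)\<close> lie in the open first quadrant; since
  \<open>(\<kappa> - S) (\<kappa> + S) = 2 x e\<^bsup>-\<lambda>r\<^esup>\<close>, the argument of the logarithm equals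
  \<open>e\<^bsup>\<lambda>r\<^esup> ((\<kappa> + S) / (\<kappa> + S\<^sub>0))\<^sup>2\<close> with a quotient in the right half plane. Hence no branch cut
  is met, and the singularity at \<open>x = 0\<close> is removable with value \<open>0\<close>.
\<close>

section \<open>The closed form as an antiderivative\<close>

declare csqrt.simps [simp del]

text \<open>Twice the product of the real and imaginary parts of the root is \<open>Im z\<close>,
  and the principal root has nonnegative real part; hence both parts are positive.\<close>

lemma csqrt_first_quadrant:
  assumes "Im z > 0"
  shows "Re (csqrt z) > 0" "Im (csqrt z) > 0"
proof -
  have e: "2 * Re (csqrt z) * Im (csqrt z) = Im z"
    by (metis power2_csqrt Im_power2)
  have "Re (csqrt z) \<ge> 0" by (rule Re_csqrt)
  moreover have "Re (csqrt z) \<noteq> 0" using e assms by auto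
  ultimately show r: "Re (csqrt z) > 0" by linarith
  show "Im (csqrt z) > 0"
    using e assms r by (metis mult_2 add_pos_pos zero_less_mult_pos)
qed

text \<open>Two arguments strictly between 0 and pi/2 differ by less than pi/2.\<close>

lemma Re_divide_first_quadrant:
  assumes "Re z > 0" "Im z > 0" "Re w > 0" "Im w > 0"
  shows "Re (z / w) > 0"
proof -
  have "(Re w)\<^sup>2 + (Im w)\<^sup>2 > 0" using assms by (simp add: sum_power2_gt_zero_iff)
  then show ?thesis using assms by (simp add: Re_divide add_pos_pos)
qed

text \<open>Doubling an argument of modulus below pi/2 stays inside the principal range.\<close>

lemma Ln_square:
  assumes "Re z > 0"
  shows "Ln (z\<^sup>2) = 2 * Ln z"
proof -
  have "z \<noteq> 0" using assms by auto
  moreover have "\<bar>Im (Ln z)\<bar> < pi / 2" by (rule Re_Ln_pos_lt_imp[OF assms])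
  ultimately have "Ln (z * z) = Ln z + Ln z" by (intro Ln_times_simple) auto
  then show ?thesis by (simp add: power2_eq_square)
qed

text \<open>For positive parameters this is \<open>i * T1\<close> (lemma \<open>T1_eq\<close>) and
  the limit of \<open>T2\<close> as time tends to infinity. Unlike \<open>T1\<close> it then lies in
  the open first quadrant.\<close>

definition kappa :: "real \<Rightarrow> real \<Rightarrow> real \<Rightarrow> complex" where
  "kappa lam b x = csqrt (2 * of_real x + \<i> * of_real lam * (of_real b)\<^sup>2)"

text \<open>The closed form with the logarithm already expanded. Its quotient of sums stays regular
  at \<open>x = 0\<close>, where the quotient inside \<open>G\<close> is 0/0.\<close>

definition ig_integral :: "real \<Rightarrow> real \<Rightarrow> real \<Rightarrow> real \<Rightarrow> real \<Rightarrow> complex" where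
  "ig_integral lam a b x t =
     - (2 * of_real a / csqrt (\<i> * of_real lam)) *
       (- T2 lam b t x + csqrt (\<i> * of_real lam) * of_real b + kappa lam b x / 2 *
         (of_real (lam * t) + 2 * Ln ((kappa lam b x + T2 lam b t x)
            / (kappa lam b x + csqrt (\<i> * of_real lam) * of_real b))))
     + of_real lam * of_real a * of_real b * of_real t"

section \<open>The closed form of one factor for positive parameters\<close>

context
  fixes lam a b :: real
  assumes lam: "lam > 0" and b: "b > 0"
begin

lemma first_quadrant:
  shows "Re (kappa lam b x) > 0" "Im (kappa lam b x) > 0"
    and "Re (T2 lam b t x) > 0" "Im (T2 lam b t x) > 0"
    and "Re (csqrt (\<i> * of_real lam)) > 0" "Im (csqrt (\<i> * of_real lam)) > 0"
  unfolding kappa_def T2_def using lam b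
  by (intro csqrt_first_quadrant; simp flip: of_real_power)+

lemma kappa_T2: "(kappa lam b x)\<^sup>2 - (T2 lam b t x)\<^sup>2 = of_real (2 * x * exp (- lam * t))"
  unfolding kappa_def T2_def by (simp add: algebra_simps)

text \<open>The radicands differ by the factor \<open>i * lam\<close>. Principal roots multiply here
  because \<open>csqrt (i * lam)\<close> has argument pi/4, while the other root has a square with
  real part \<open>b^2 > 0\<close> and so an argument of modulus below pi/4; the product has
  positive real part. This identifies \<open>T2\<close> with the root in
  \<open>ig_exponent\<close>.\<close>

lemma T2_eq:
  "T2 lam b t x = csqrt (\<i> * of_real lam) *
     csqrt (- 2 * \<i> * of_real (x * (1 - exp (- lam * t)) / lam) + (of_real b)\<^sup>2)" (is "_ = ?s * ?w")
  unfolding T2_def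
proof (rule csqrt_unique)
  define y where "y = x * (1 - exp (- lam * t))"
  show "(?s * ?w)\<^sup>2 = 2 * of_real x * (1 - of_real (exp (- lam * t))) + \<i> * of_real lam * (of_real b)\<^sup>2"
    using lam by (simp add: power_mult_distrib field_simps)
  have r: "Re ?w > 0"
  proof -
    have "(Re ?w)\<^sup>2 - (Im ?w)\<^sup>2 = b\<^sup>2"
      unfolding Re_power2[symmetric] power2_csqrt by (simp flip: of_real_power)
    then have "Re ?w \<noteq> 0" using b by (smt (verit) power2_less_0 zero_eq_power2 zero_less_power)
    then show ?thesis using Re_csqrt[of "- 2 * \<i> * of_real (x * (1 - exp (- lam * t)) / lam) + (of_real b)\<^sup>2"] by linarith
  qed
  have i: "\<bar>Im ?w\<bar> < Re ?w"
  proof -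
    have "(Re ?w)\<^sup>2 - (Im ?w)\<^sup>2 = b\<^sup>2"
      unfolding Re_power2[symmetric] power2_csqrt by (simp flip: of_real_power)
    then have "(Im ?w)\<^sup>2 < (Re ?w)\<^sup>2" using b by (smt (verit) zero_less_power)
    then show ?thesis using r by (metis abs_of_pos power2_abs power2_less_imp_less less_imp_le)
  qed
  have "Re ?s = Im ?s"
  proof -
    have "(Re ?s)\<^sup>2 - (Im ?s)\<^sup>2 = 0"
      unfolding Re_power2[symmetric] power2_csqrt by simp
    then show ?thesis using first_quadrant(5,6) by (simp add: power2_eq_iff)
  qed
  then have "Re (?s * ?w) = Re ?s * (Re ?w - Im ?w)"
    by (simp add: algebra_simps)
  then have "Re (?s * ?w) > 0" using i first_quadrant(5) by simp
  then show "0 < Re (?s * ?w) \<or> Re (?s * ?w) = 0 \<and> 0 \<le> Im (?s * ?w)" ..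
qed

lemma T2_0: "T2 lam b 0 x = csqrt (\<i> * of_real lam) * of_real b"
  using b by (subst T2_eq) (simp add: csqrt_of_real flip: of_real_power)

lemma T1_eq: "\<i> * T1 lam b x = kappa lam b x"
proof -
  have "csqrt (- (- 2 * of_real x - \<i> * of_real lam * (of_real b)\<^sup>2)) = \<i> * T1 lam b x"
    unfolding T1_def using lam b by (intro csqrt_minus) (simp flip: of_real_power)
  then show ?thesis by (simp add: kappa_def add.commute)
qed

lemma I_formula_eq:
  assumes x: "x \<noteq> 0"
  shows "I_formula lam a b t x = ig_integral lam a b x t"
proof -
  define k S s0 where "k = kappa lam b x" and "S = T2 lam b t x"
    and "s0 = csqrt (\<i> * of_real lam) * of_real b"
  have s0: "s0 = T2 lam b 0 x" by (simp add: s0_def T2_0)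
  have T1: "T1 lam b x = - \<i> * k"
    unfolding k_def T1_eq[symmetric] by simp
  have d1: "(k - S) * (k + S) = of_real (2 * x * exp (- lam * t))"
    using kappa_T2[where x = x and t = t] by (simp add: k_def S_def power2_eq_square algebra_simps)
  have d0: "(k - s0) * (k + s0) = of_real (2 * x)"
    using kappa_T2[of x 0] by (simp add: k_def s0 power2_eq_square algebra_simps)
  have pos: "Re (k + S) > 0" "Im (k + S) > 0" "Re (k + s0) > 0" "Im (k + s0) > 0"
    unfolding k_def S_def s0 using first_quadrant(1-4) by (simp_all add: add_pos_pos)
  have nz: "k + S \<noteq> 0" "k + s0 \<noteq> 0" "k - S \<noteq> 0" "k - s0 \<noteq> 0"
    using pos d1 d0 x by auto
  define q where "q = (k + S) / (k + s0)"
  have Re_q: "Re q > 0" unfolding q_def by (rule Re_divide_first_quadrant[OF pos])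
  \<comment> \<open>The two difference-of-squares identities trade differences for sums, and the
    common nonzero factor \<open>2 * x\<close> cancels.\<close>
  have e: "of_real (exp (- lam * t)) * ((k - s0) / (k - S)) = q"
  proof -
    have "k - S = of_real (2 * x * exp (- lam * t)) / (k + S)"
      using d1 nz by (simp add: field_simps)
    moreover have "k - s0 = of_real (2 * x) / (k + s0)"
      using d0 nz by (simp add: field_simps)
    ultimately show ?thesis
      using x nz unfolding q_def by simp
  qed
  have i: "T1 lam b x + \<i> * s0 = - \<i> * (k - s0)" "T1 lam b x + \<i> * S = - \<i> * (k - S)"
    by (simp_all add: T1 algebra_simps)
  have "of_real (exp (- lam * t)) * ((T1 lam b x + \<i> * s0)\<^sup>2 / (T1 lam b x + \<i> * S)\<^sup>2)
     = of_real (exp (lam * t)) * (of_real (exp (- lam * t)) * ((k - s0) / (k - S)))\<^sup>2"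
    unfolding i using nz
    by (simp add: power_mult_distrib power_divide power2_eq_square exp_minus)
  also have "\<dots> = of_real (exp (lam * t)) * q\<^sup>2" unfolding e ..
  finally have "G lam b t x = Ln (of_real (exp (lam * t)) * q\<^sup>2)"
    unfolding G_def S_def[symmetric] s0_def by (simp add: mult.assoc)
  \<comment> \<open>A positive real factor leaves the argument unchanged, so the logarithm splits
    without a branch correction.\<close>
  also have "\<dots> = Ln (of_real (exp (lam * t))) + Ln (q\<^sup>2)"
    using Re_q by (intro Ln_times_of_real) auto
  also have "\<dots> = of_real (lam * t) + 2 * Ln q"
    by (simp add: Ln_square[OF Re_q] Ln_of_real)
  finally have G: "G lam b t x = of_real (lam * t) + 2 * Ln q" .
  show ?thesis
    unfolding I_formula_def ig_integral_def G T1 unfolding k_def[symmetric] S_def[symmetric] s0_def[symmetric] q_def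
    by simp
qed

text \<open>At time 0, \<open>T2\<close> cancels against \<open>csqrt (i * lam) * b\<close>, and the
  quotient under \<open>Ln\<close> is 1 once its denominator is known to be nonzero.\<close>

lemma ig_integral_0: "ig_integral lam a b x 0 = 0"
proof -
  have "Re (kappa lam b x + T2 lam b 0 x) > 0"
    using first_quadrant(1,3) by (simp add: add_pos_pos)
  then have "kappa lam b x + csqrt (\<i> * of_real lam) * of_real b \<noteq> 0"
    unfolding T2_0 by (metis less_irrefl zero_complex.sel(1))
  then show ?thesis unfolding ig_integral_def T2_0 by simp
qed

text \<open>The relation between \<open>k\<close> and \<open>S\<close> reduces the derivative of the
  bracket to \<open>lam * S / 2\<close>, and \<open>T2_eq\<close> turns \<open>S\<close> into the
  root in the exponent.\<close>

lemma ig_integral_derivative: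
  "((\<lambda>r. ig_integral lam a b x r) has_vector_derivative
     of_real lam * ig_exponent a b (x * (1 - exp (- lam * t)) / lam)) (at t)"
proof -
  define k s where "k = kappa lam b x" and "s = csqrt (\<i> * of_real lam)"
  define S where "S r = T2 lam b r x" for r
  have pos: "Re (k + S r) > 0" "Im (k + S r) > 0" "Re (k + s * of_real b) > 0" "Im (k + s * of_real b) > 0" for r
    using first_quadrant(1,2)[of x] first_quadrant(3,4)[of _ x] unfolding k_def S_def s_def T2_0[of x, symmetric] by (simp_all add: add_pos_pos)
  have nz: "k + S r \<noteq> 0" "k + s * of_real b \<noteq> 0" "S r \<noteq> 0" "s \<noteq> 0" for r
    using pos(1,2)[of r] pos(3,4) first_quadrant(3)[of r x] first_quadrant(5)
    by (auto simp: S_def s_def complex_eq_iff)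
  have Re_q: "Re ((k + S r) / (k + s * of_real b)) > 0" for r
    by (rule Re_divide_first_quadrant[OF pos])
  define S' where "S' = of_real (x * lam * exp (- lam * t)) / S t"
  define p where "p r = 2 * complex_of_real x * (1 - of_real (exp (- lam * r))) + \<i> * of_real lam * (of_real b)\<^sup>2" for r
  \<comment> \<open>The imaginary part is the positive constant \<open>lam * b^2\<close>, so the
    radicand never meets the branch cut of the root.\<close>
  have p: "p r \<notin> \<real>\<^sub>\<le>\<^sub>0" for r
    using lam b by (simp add: p_def complex_nonpos_Reals_iff flip: of_real_power)
  have Dp: "(p has_vector_derivative of_real (2 * x * lam * exp (- lam * t))) (at t)"
    unfolding p_def has_vector_derivative_def
    by (auto intro!: derivative_eq_intros simp: scaleR_conv_of_real)
  have "(csqrt \<circ> p has_vector_derivative of_real (2 * x * lam * exp (- lam * t)) * inverse (2 * csqrt (p t))) (at t)"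
    by (rule field_vector_diff_chain_at[OF Dp has_field_derivative_csqrt[OF p]])
  moreover have SS: "csqrt (p r) = S r" for r unfolding S_def T2_def p_def ..
  then have "csqrt \<circ> p = S" by (intro ext) simp
  moreover have "S' = of_real (2 * x * lam * exp (- lam * t)) * inverse (2 * csqrt (p t))"
    unfolding S'_def SS using nz(3)[of t] by (simp add: field_simps)
  ultimately have DS: "(S has_vector_derivative S') (at t)"
    by metis
  have "(Ln \<circ> (\<lambda>r. (k + S r) / (k + s * of_real b)) has_vector_derivative
      S' / (k + s * of_real b) * inverse ((k + S t) / (k + s * of_real b))) (at t)"
  proof (rule field_vector_diff_chain_at)
    have "((\<lambda>r. k + S r) has_vector_derivative S') (at t)"
      using has_vector_derivative_add[OF has_vector_derivative_const DS, of k] by simp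
    then show "((\<lambda>r. (k + S r) / (k + s * of_real b)) has_vector_derivative S' / (k + s * of_real b)) (at t)"
      by (rule bounded_linear.has_vector_derivative[OF bounded_linear_divide])
    show "(Ln has_field_derivative inverse ((k + S t) / (k + s * of_real b))) (at ((k + S t) / (k + s * of_real b)))"
      using Re_q[of t] by (intro has_field_derivative_Ln) (auto simp: complex_nonpos_Reals_iff)
  qed
  then have DL: "((\<lambda>r. Ln ((k + S r) / (k + s * of_real b))) has_vector_derivative S' / (k + S t)) (at t)"
    using nz by (simp add: o_def)
  have D: "((\<lambda>r. ig_integral lam a b x r) has_vector_derivative
     - (2 * of_real a / s) * (- S' + k / 2 * (of_real lam + 2 * (S' / (k + S t)))) + of_real (lam * a * b)) (at t)"
    unfolding ig_integral_def k_def[symmetric] s_def[symmetric] S_def[symmetric]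
    by (auto intro!: derivative_eq_intros DS DL has_vector_derivative_of_real)
  have "(k - S t) * (k + S t) = of_real (2 * x * exp (- lam * t))"
    using kappa_T2[where x = x and t = t] by (simp add: k_def S_def power2_eq_square algebra_simps)
  then have e: "2 * S' * S t = of_real lam * ((k - S t) * (k + S t))"
    using nz(3)[of t] by (simp add: S'_def)
  \<comment> \<open>\<open>q\<close> is the derivative of the logarithm. Dividing \<open>e\<close>
    by \<open>k + S\<close> gives \<open>2 * q * S = lam * (k - S)\<close>, after which
    \<open>- q * (k + S) + k / 2 * (lam + 2 * q)\<close> simplifies to
    \<open>lam * S / 2\<close>.\<close>
  define q where "q = S' / (k + S t)"
  have S': "S' = q * (k + S t)"
    using nz(1)[of t] by (simp add: q_def)
  have "2 * q * S t * (k + S t) = 2 * S' * S t"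
    unfolding S' by (simp only: mult_ac)
  also note e
  finally have "2 * q * S t * (k + S t) = of_real lam * (k - S t) * (k + S t)"
    by (simp only: mult_ac)
  then have "2 * q * S t = of_real lam * (k - S t)"
    using nz(1)[of t] by simp
  then have *: "- S' + k / 2 * (of_real lam + 2 * (S' / (k + S t))) = of_real lam * S t / 2"
    unfolding q_def[symmetric] unfolding S' by (simp add: algebra_simps)
  have "S t = s * csqrt (- 2 * \<i> * of_real (x * (1 - exp (- lam * t)) / lam) + (of_real b)\<^sup>2)"
    unfolding S_def s_def by (rule T2_eq)
  then have "- (2 * of_real a / s) * (of_real lam * S t / 2) + of_real (lam * a * b)
     = of_real lam * ig_exponent a b (x * (1 - exp (- lam * t)) / lam)"
    unfolding ig_exponent_def using nz(4) by (simp add: algebra_simps)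
  with D show ?thesis unfolding * by simp
qed

text \<open>At \<open>x = 0\<close> both \<open>kappa\<close> and \<open>T2\<close> equal
  \<open>csqrt (i * lam) * b\<close>, so the logarithm is \<open>Ln 1\<close> and the remaining
  terms cancel. Their radicand \<open>i * lam * b^2\<close> is off the branch cut, so every
  ingredient is continuous there.\<close>

lemma ig_integral_at_0:
  shows "ig_integral lam a b 0 t = 0" "((\<lambda>x. ig_integral lam a b x t) \<longlongrightarrow> 0) (at 0)"
proof -
  define s where "s = csqrt (\<i> * of_real lam)"
  have nz: "s \<noteq> 0" using first_quadrant(5) by (auto simp: s_def)
  have im: "\<i> * of_real lam * (of_real b)\<^sup>2 \<notin> \<real>\<^sub>\<le>\<^sub>0"
    using lam b by (simp add: complex_nonpos_Reals_iff flip: of_real_power)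
  have k0: "kappa lam b 0 = s * of_real b" and T0: "T2 lam b t 0 = s * of_real b"
    using T2_0[of 0] by (simp_all add: kappa_def T2_def s_def)
  have k: "((\<lambda>x. kappa lam b x) \<longlongrightarrow> kappa lam b 0) (at 0)"
    unfolding kappa_def using im by (intro isCont_tendsto_compose[OF continuous_at_csqrt] tendsto_intros) auto
  have T: "((\<lambda>x. T2 lam b t x) \<longlongrightarrow> T2 lam b t 0) (at 0)"
    unfolding T2_def using im by (intro isCont_tendsto_compose[OF continuous_at_csqrt] tendsto_intros) auto
  have "((\<lambda>x. ig_integral lam a b x t) \<longlongrightarrow> ig_integral lam a b 0 t) (at 0)"
    unfolding ig_integral_def s_def[symmetric] using nz b k0 T0
    by (intro tendsto_intros k T) auto
  moreover show "ig_integral lam a b 0 t = 0"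
    unfolding ig_integral_def k0 T0 s_def[symmetric] using nz b by simp
  ultimately show "((\<lambda>x. ig_integral lam a b x t) \<longlongrightarrow> 0) (at 0)" by simp
qed

text \<open>Away from 0 this is \<open>I_formula_eq\<close>; the limit in \<open>I_plus\<close> sees
  only such arguments, so it is the limit of \<open>ig_integral\<close>.\<close>

lemma I_plus_eq: "I_plus lam a b t x = ig_integral lam a b x t"
proof (cases "x = 0")
  case True
  have "(I_formula lam a b t \<longlongrightarrow> 0) (at 0)"
    by (rule Lim_transform_eventually[OF ig_integral_at_0(2)[of t]])
       (simp add: I_formula_eq eventually_at_filter)
  then have "I_plus lam a b t x = 0" 
    using True by (simp add: I_plus_def tendsto_Lim)
  then show ?thesis using True ig_integral_at_0(1) by simp
qed (simp add: I_plus_def I_formula_eq)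

end

section \<open>Paths of the integrated process\<close>

text \<open>With \<open>X\<close> only integrable, integration by parts is done by Fubini on the
  triangle \<open>0 <= r <= s <= t\<close>: for fixed \<open>r\<close> the inner integral of
  \<open>u\<close> from \<open>r\<close> to \<open>t\<close> is \<open>U t - U r\<close>.\<close>

lemma set_integral_indefinite:
  fixes X u U :: "real \<Rightarrow> real"
  assumes X: "set_integrable lborel {0..t} X"
    and U: "\<And>r. (U has_real_derivative u r) (at r)" and u: "continuous_on UNIV u"
  shows "set_integrable lborel {0..t} (\<lambda>s. u s * (LINT r:{0..s}|lborel. X r))"
    and "(LINT s:{0..t}|lborel. u s * (LINT r:{0..s}|lborel. X r)) =
      (LINT r:{0..t}|lborel. (U t - U r) * X r)"
proof -
  have sub: "set_integrable lborel {0..s} X" if "s \<le> t" for s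
    using X that by (auto intro: set_integrable_subset)
  have "continuous_on {0..t} (\<lambda>s. integral {0..s} X)"
    by (intro indefinite_integral_continuous_1 set_borel_integral_eq_integral(1)[OF X])
  then have "continuous_on {0..t} (\<lambda>s. LINT r:{0..s}|lborel. X r)"
    by (rule continuous_on_cong[THEN iffD1, OF refl, rotated])
       (simp add: set_borel_integral_eq_integral(2)[OF sub])
  then show "set_integrable lborel {0..t} (\<lambda>s. u s * (LINT r:{0..s}|lborel. X r))"
    by (intro borel_integrable_atLeastAtMost' continuous_intros continuous_on_subset[OF u]) auto
  \<comment> \<open>The indicators of the interval are absorbed into \<open>g\<close> and
    \<open>h\<close>, so that their product is integrable on the plane and only the condition
    \<open>r <= s\<close> remains to be imposed.\<close>
  define g h where "g r = indicator {0..t} r * X r" and "h s = indicator {0..t} s * u s" for r s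
  have g: "integrable lborel g"
    using X by (simp add: g_def[abs_def] set_integrable_def)
  have h: "integrable lborel h"
    using borel_integrable_atLeastAtMost'[OF continuous_on_subset[OF u subset_UNIV], of 0 t]
    by (simp add: h_def[abs_def] set_integrable_def)
  note [measurable] = borel_measurable_integrable[OF g] borel_measurable_integrable[OF h]
  have "{p :: real \<times> real. fst p \<le> snd p} \<in> sets borel"
    by (intro borel_closed closed_Collect_le continuous_intros)
  then have [measurable]: "{p :: real \<times> real. fst p \<le> snd p} \<in> sets (borel \<Otimes>\<^sub>M borel)"
    unfolding borel_prod .
  have "integrable (lborel \<Otimes>\<^sub>M lborel) (\<lambda>p. g (fst p) * h (snd p))"
    using g h by (intro lborel_pair.Fubini_integrable) (auto simp: abs_mult)
  then have "integrable (lborel \<Otimes>\<^sub>M lborel) (\<lambda>p. (g (fst p) * h (snd p)) * indicator {p. fst p \<le> snd p} p)"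
    by (rule integrable_real_mult_indicator[rotated]) measurable
  then have int: "integrable (lborel \<Otimes>\<^sub>M lborel) (\<lambda>(r, s). g r * h s * indicator {..s} r)"
    by (rule Bochner_Integration.integrable_cong[THEN iffD1, OF refl, rotated])
       (auto split: split_indicator)
  have "(LINT s:{0..t}|lborel. u s * (LINT r:{0..s}|lborel. X r)) =
      (\<integral>s. (\<integral>r. g r * h s * indicator {..s} r \<partial>lborel) \<partial>lborel)"
    unfolding set_lebesgue_integral_def g_def h_def
    by (intro Bochner_Integration.integral_cong refl, simp flip: integral_mult_right_zero,
        intro Bochner_Integration.integral_cong refl) (auto split: split_indicator)
  also have "\<dots> = (\<integral>r. (\<integral>s. g r * h s * indicator {..s} r \<partial>lborel) \<partial>lborel)"
    by (rule lborel_pair.Fubini_integral[OF int])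
  also have "\<dots> = (LINT r:{0..t}|lborel. (U t - U r) * X r)"
    unfolding set_lebesgue_integral_def
  proof (intro Bochner_Integration.integral_cong refl)
    fix r :: real
    show "(\<integral>s. g r * h s * indicator {..s} r \<partial>lborel) = indicat_real {0..t} r *\<^sub>R ((U t - U r) * X r)"
    proof (cases "r \<in> {0..t}")
      case True
      have "(\<integral>s. indicator {r..t} s *\<^sub>R u s \<partial>lborel) = U t - U r"
        using True U u 
        by (intro integral_FTC_atLeastAtMost)
           (auto intro: has_field_derivative_at_within continuous_on_subset
             simp flip: has_real_derivative_iff_has_vector_derivative)
      moreover have "g r * h s * indicator {..s} r = X r * (indicator {r..t} s *\<^sub>R u s)" for s
        using True by (auto simp: g_def h_def split: split_indicator)
      ultimately show ?thesis using True by simp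
    qed (simp add: g_def)
  qed
  finally show "(LINT s:{0..t}|lborel. u s * (LINT r:{0..s}|lborel. X r)) =
      (LINT r:{0..t}|lborel. (U t - U r) * X r)" .
qed

text \<open>Integrating factor: with \<open>Y\<close> the integral of \<open>X\<close>, formally
  \<open>(exp (lam * s) * Y s)' = exp (lam * s) * (X s + lam * Y s)\<close>, and the equation says
  that the last bracket is \<open>m s\<close>. The parts formula stands in for this derivative,
  which need not exist everywhere.\<close>

lemma ou_path_solution:
  fixes X m :: "real \<Rightarrow> real"
  assumes lam: "lam > 0" and t: "t \<ge> 0"
    and X: "set_integrable lborel {0..t} X"
    and eq: "\<And>s. s \<in> {0..t} \<Longrightarrow> X s = m s - lam * (LINT r:{0..s}|lborel. X r)"
  shows "((\<lambda>s. exp (lam * s) * m s) has_integral exp (lam * t) * (LINT s:{0..t}|lborel. X s)) {0..t}"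
proof -
  define Y where "Y s = (LINT r:{0..s}|lborel. X r)" for s
  have D: "((\<lambda>r. exp (lam * r)) has_real_derivative lam * exp (lam * r)) (at r)" for r
    by (auto intro!: derivative_eq_intros)
  have C: "continuous_on UNIV (\<lambda>r. lam * exp (lam * r))"
    by (intro continuous_intros)
  note parts = set_integral_indefinite[OF X D C]
  have iY: "set_integrable lborel {0..t} (\<lambda>s. lam * exp (lam * s) * Y s)"
    using parts(1) by (simp add: Y_def)
  have iX: "set_integrable lborel {0..t} (\<lambda>s. exp (lam * s) * X s)"
    unfolding set_integrable_def
  proof (rule Bochner_Integration.integrable_bound)
    show "integrable lborel (\<lambda>s. exp (lam * t) * (indicator {0..t} s *\<^sub>R X s))"
      using X unfolding set_integrable_def by simp
    have "(\<lambda>s. exp (lam * s) * (indicator {0..t} s *\<^sub>R X s)) \<in> borel_measurable lborel"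
      using X unfolding set_integrable_def by measurable
    then show "(\<lambda>s. indicator {0..t} s *\<^sub>R (exp (lam * s) * X s)) \<in> borel_measurable lborel"
      by (simp add: mult_ac)
    show "AE s in lborel. norm (indicator {0..t} s *\<^sub>R (exp (lam * s) * X s))
        \<le> norm (exp (lam * t) * (indicator {0..t} s *\<^sub>R X s))"
      using lam by (auto simp: abs_mult intro!: mult_right_mono split: split_indicator)
  qed
  have *: "(LINT s:{0..t}|lborel. (exp (lam * t) - exp (lam * s)) * X s)
     = exp (lam * t) * Y t - (LINT s:{0..t}|lborel. exp (lam * s) * X s)"
    using set_integral_diff(2)[of lborel "{0..t}" "\<lambda>s. exp (lam * t) * X s" "\<lambda>s. exp (lam * s) * X s"] iX X
    by (simp add: left_diff_distrib Y_def)
  have "(LINT s:{0..t}|lborel. exp (lam * s) * X s + lam * exp (lam * s) * Y s) = exp (lam * t) * Y t"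
    using parts(2) * by (subst set_integral_add(2)[OF iX iY]) (simp add: Y_def)
  moreover have "((\<lambda>s. exp (lam * s) * X s + lam * exp (lam * s) * Y s) has_integral
      (LINT s:{0..t}|lborel. exp (lam * s) * X s + lam * exp (lam * s) * Y s)) {0..t}"
    using set_borel_integral_eq_integral[OF set_integral_add(1)[OF iX iY]]
    by (simp add: integrable_integral)
  ultimately have "((\<lambda>s. exp (lam * s) * X s + lam * exp (lam * s) * Y s) has_integral exp (lam * t) * Y t) {0..t}"
    by simp
  then have "((\<lambda>s. exp (lam * s) * m s) has_integral exp (lam * t) * Y t) {0..t}"
    by (rule has_integral_eq[rotated]) (simp add: eq Y_def algebra_simps)
  then show ?thesis by (simp add: Y_def)
qed

section \<open>Riemann-Stieltjes sums of monotone paths\<close>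

lemma mono_stieltjes_sum_bound:
  fixes z w e :: "real \<Rightarrow> real"
  assumes ab: "\<And>j. j \<le> n \<Longrightarrow> \<tau> j \<in> {0..t}" "mono \<tau>" "\<tau> 0 = 0" "\<And>j. \<tau> (Suc j) - \<tau> j = d"
    and z: "mono_on {0..t} z"
    and e: "\<And>r. (e has_real_derivative w r) (at r)"
    and w0: "\<And>r. r \<in> {0..t} \<Longrightarrow> 0 \<le> w r" and wB: "\<And>r. r \<in> {0..t} \<Longrightarrow> w r \<le> B"
    and int: "(\<lambda>r. w r * z r) integrable_on {0..t}"
    and "j \<le> n"
  shows "\<bar>(\<Sum>k<j. z (\<tau> (Suc k)) * (e (\<tau> (Suc k)) - e (\<tau> k))) - integral {0..\<tau> j} (\<lambda>r. w r * z r)\<bar>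
    \<le> B * d * (z (\<tau> j) - z 0)"
  using \<open>j \<le> n\<close>
proof (induction j)
  case 0
  then show ?case using ab(3) by simp
next
  case (Suc j)
  define p q where "p = \<tau> j" and "q = \<tau> (Suc j)"
  have pq: "0 \<le> p" "p \<le> q" "q \<le> t" "q - p = d"
    using Suc.prems ab(1)[of j] ab(1)[of "Suc j"] monoD[OF ab(2), of j "Suc j"] ab(4)[of j]
    by (auto simp: p_def q_def)
  have iq: "(\<lambda>r. w r * z r) integrable_on {0..q}" and ipq: "(\<lambda>r. w r * z r) integrable_on {p..q}"
    using pq by (auto intro: integrable_on_subinterval[OF int])
  have split: "integral {0..q} (\<lambda>r. w r * z r) = integral {0..p} (\<lambda>r. w r * z r) + integral {p..q} (\<lambda>r. w r * z r)"
    using Henstock_Kurzweil_Integration.integral_combine[OF pq(1,2) iq] by simp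
  have ew: "(w has_integral e q - e p) {p..q}"
    using pq e by (intro fundamental_theorem_of_calculus)
      (auto intro: has_field_derivative_at_within simp flip: has_real_derivative_iff_has_vector_derivative)
  \<comment> \<open>Monotonicity traps the cell integral between the left and right endpoint values
    of \<open>z\<close> times \<open>e q - e p\<close>. The error of the right endpoint is at most
    \<open>B * d\<close> times the increment of \<open>z\<close>, and these increments telescope
    along the induction.\<close>
  have lo: "z p * (e q - e p) \<le> integral {p..q} (\<lambda>r. w r * z r)"
    using has_integral_mult_right[OF ew, of "z p"] integrable_integral[OF ipq]
    by (rule has_integral_le) (use pq w0 mono_onD[OF z] in \<open>auto simp: mult.commute intro!: mult_left_mono\<close>)
  have hi: "integral {p..q} (\<lambda>r. w r * z r) \<le> z q * (e q - e p)"
    using integrable_integral[OF ipq] has_integral_mult_right[OF ew, of "z q"]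
    by (rule has_integral_le) (use pq w0 mono_onD[OF z] in \<open>auto simp: mult.commute intro!: mult_left_mono\<close>)
  have "e q - e p \<le> B * d"
    using has_integral_le[OF ew has_integral_const_real[of B p q]] pq wB by (auto simp: mult.commute)
  moreover have "z p \<le> z q" using pq mono_onD[OF z] by auto
  ultimately have "(z q - z p) * (e q - e p) \<le> (z q - z p) * (B * d)"
    by (intro mult_left_mono) auto
  then have "\<bar>z q * (e q - e p) - integral {p..q} (\<lambda>r. w r * z r)\<bar> \<le> B * d * (z q - z p)"
    using lo hi by (simp add: algebra_simps)
  then show ?case
    using Suc unfolding sum.lessThan_Suc p_def[symmetric] q_def[symmetric] split
    by (simp add: algebra_simps)
qed

lemma summation_by_parts:
  fixes e z :: "nat \<Rightarrow> real"
  shows "(\<Sum>k<n. (e n - e k) * (z (Suc k) - z k)) = (\<Sum>k<n. z (Suc k) * (e (Suc k) - e k)) - z 0 * (e n - e 0)"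
proof -
  \<comment> \<open>The constant \<open>c\<close> is kept apart from \<open>e n\<close>, since the
    induction moves the upper index; for \<open>c = e n\<close> and \<open>j = n\<close> the last
    term vanishes.\<close>
  have "(\<Sum>k<j. (c - e k) * (z (Suc k) - z k)) =
      (\<Sum>k<j. z (Suc k) * (e (Suc k) - e k)) - z 0 * (c - e 0) + z j * (c - e j)" for c :: real and j :: nat
    by (induction j) (simp_all add: algebra_simps)
  from this[of "e n" n] show ?thesis by simp
qed

text \<open>Summation by parts moves the increments from \<open>z\<close> to \<open>e\<close> and
  gives a right endpoint sum for the integral. Its error is of order \<open>t / n\<close> because
  the monotone path has finite variation \<open>z t - z 0\<close>.\<close>

lemma mono_stieltjes_sum_tendsto:
  fixes z w e :: "real \<Rightarrow> real" and t :: real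
  assumes t: "t \<ge> 0" and z: "mono_on {0..t} z"
    and e: "\<And>r. (e has_real_derivative w r) (at r)"
    and w0: "\<And>r. r \<in> {0..t} \<Longrightarrow> 0 \<le> w r" and wB: "\<And>r. r \<in> {0..t} \<Longrightarrow> w r \<le> B"
    and int: "((\<lambda>r. w r * z r) has_integral I) {0..t}"
  shows "(\<lambda>n::nat. \<Sum>k<n. (e t - e (real k * t / real n)) * (z (Suc k * t / real n) - z (real k * t / real n)))
    \<longlonglongrightarrow> I - z 0 * (e t - e 0)"
proof -
  \<comment> \<open>Positivity of \<open>n\<close> makes the last node equal to \<open>t\<close>;
    division by zero would place it at 0.\<close>
  have bound: "norm ((\<Sum>k<n. (e t - e (real k * t / real n)) * (z (Suc k * t / real n) - z (real k * t / real n))) - (I - z 0 * (e t - e 0)))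
     \<le> B * (t / real n) * (z t - z 0)" if n: "n > 0" for n :: nat
  proof -
    define \<tau> where "\<tau> k = real k * t / real n" for k :: nat
    have m: "t * real i \<le> t * real j" if "i \<le> j" for i j :: nat
      using that t by (intro mult_left_mono) auto
    have \<tau>: "\<tau> 0 = 0" "\<tau> n = t" "mono \<tau>" "\<And>j. j \<le> n \<Longrightarrow> \<tau> j \<in> {0..t}" "\<And>j. \<tau> (Suc j) - \<tau> j = t / real n"
      using n t by (auto simp: \<tau>_def mono_def divide_simps m algebra_simps)
    have "\<bar>(\<Sum>k<n. z (\<tau> (Suc k)) * (e (\<tau> (Suc k)) - e (\<tau> k))) - integral {0..\<tau> n} (\<lambda>r. w r * z r)\<bar>
      \<le> B * (t / real n) * (z (\<tau> n) - z 0)"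
      using mono_stieltjes_sum_bound[where \<tau> = \<tau> and n = n and d = "t / real n" and j = n and t = t,
          OF \<tau>(4,3,1,5) z e w0 wB] int by blast
    moreover have "(\<Sum>k<n. (e t - e (\<tau> k)) * (z (\<tau> (Suc k)) - z (\<tau> k))) =
        (\<Sum>k<n. z (\<tau> (Suc k)) * (e (\<tau> (Suc k)) - e (\<tau> k))) - z 0 * (e t - e 0)"
      using summation_by_parts[where n = n and e = "\<lambda>k. e (\<tau> k)" and z = "\<lambda>k. z (\<tau> k)"] by (simp add: \<tau>)
    ultimately show ?thesis
      using \<tau>(1,2) integral_unique[OF int] by (simp add: \<tau>_def)
  qed
  have lim: "(\<lambda>n. B * (t / real n) * (z t - z 0)) \<longlonglongrightarrow> B * 0 * (z t - z 0)"
    by (intro tendsto_intros lim_const_over_n)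
  have "(\<lambda>n. (\<Sum>k<n. (e t - e (real k * t / real n)) * (z (Suc k * t / real n) - z (real k * t / real n))) - (I - z 0 * (e t - e 0))) \<longlonglongrightarrow> 0"
  proof (rule Lim_null_comparison[rotated])
    show "(\<lambda>n. B * (t / real n) * (z t - z 0)) \<longlonglongrightarrow> 0" using lim by simp
    show "\<forall>\<^sub>F n in sequentially. norm ((\<Sum>k<n. (e t - e (real k * t / real n)) * (z (Suc k * t / real n) - z (real k * t / real n))) - (I - z 0 * (e t - e 0)))
      \<le> B * (t / real n) * (z t - z 0)"
      using eventually_gt_at_top[of 0] by (rule eventually_mono) (rule bound)
  qed
  then show ?thesis by (rule LIM_zero_cancel)
qed

lemma ou_path_stieltjes_sum:
  fixes X Z :: "real \<Rightarrow> real" and t :: real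
  assumes lam: "lam > 0" and t: "t \<ge> 0"
    and Z: "mono_on {0..} Z" and Z0: "Z 0 = 0"
    and X: "set_integrable lborel {0..t} X"
    and eq: "\<And>s. s \<in> {0..t} \<Longrightarrow> X s = x0 - lam * (LINT r:{0..s}|lborel. X r) + Z (lam * s)"
  shows "(\<lambda>n::nat. \<Sum>k<n. (1 - exp (- lam * (t - real k * t / real n))) / lam * (Z (lam * (Suc k * t / real n)) - Z (lam * (real k * t / real n))))
    \<longlonglongrightarrow> (LINT s:{0..t}|lborel. X s) - inverse lam * (1 - exp (- lam * t)) * x0"
proof -
  define Y where "Y = (LINT s:{0..t}|lborel. X s)"
  define w where "w r = exp (- lam * (t - r))" for r
  have w_eq: "w r = exp (- lam * t) * exp (lam * r)" for r
    by (simp add: w_def algebra_simps flip: exp_add)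
  \<comment> \<open>The primitive of the weight \<open>w\<close> is normalised so that
    \<open>e t - e r\<close> is the kernel \<open>(1 - exp (- lam * (t - r))) / lam\<close> of the
    stochastic integral.\<close>
  define e where "e r = w r / lam" for r
  have De: "(e has_real_derivative w r) (at r)" for r
    unfolding e_def w_def using lam by (auto intro!: derivative_eq_intros)
  have "((\<lambda>s. exp (lam * s) * (x0 + Z (lam * s))) has_integral exp (lam * t) * Y) {0..t}"
    unfolding Y_def by (rule ou_path_solution[OF lam t X]) (use eq in auto)
  from has_integral_mult_right[OF this, of "exp (- lam * t)"]
  have "((\<lambda>s. w s * (x0 + Z (lam * s))) has_integral Y) {0..t}"
    by (simp add: w_eq mult.assoc flip: exp_add) (simp add: mult.assoc[symmetric] flip: exp_add)
  moreover have mono: "mono_on {0..t} (\<lambda>s. x0 + Z (lam * s))"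
    using lam mono_onD[OF Z] by (auto simp: mono_on_def)
  \<comment> \<open>The bound is \<open>B = 1\<close>, as the weight is at most 1 on
    \<open>{0..t}\<close>. The start value \<open>x0 + Z 0 = x0\<close> produces the deterministic
    term.\<close>
  ultimately have "(\<lambda>n::nat. \<Sum>k<n. (e t - e (real k * t / real n)) * ((x0 + Z (lam * (Suc k * t / real n))) - (x0 + Z (lam * (real k * t / real n)))))
    \<longlonglongrightarrow> Y - (x0 + Z (lam * 0)) * (e t - e 0)"
    using lam by (intro mono_stieltjes_sum_tendsto[OF t mono De, where B = 1]) (auto simp: w_def)
  then show ?thesis
    by (simp add: e_def w_def Z0 Y_def divide_inverse algebra_simps)
qed

section \<open>Riemann sums evaluated by a primitive\<close>

lemma riemann_sum_tendsto:
  fixes f P :: "real \<Rightarrow> 'b::real_normed_vector"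
  assumes t: "t \<ge> 0" and P: "\<And>r. (P has_vector_derivative f r) (at r)"
    and f: "continuous_on {0..t} f"
  shows "(\<lambda>n::nat. \<Sum>k<n. (t / real n) *\<^sub>R f (real k * t / real n)) \<longlonglongrightarrow> P t - P 0"
proof (rule LIMSEQ_I)
  fix \<epsilon> :: real assume "\<epsilon> > 0"
  \<comment> \<open>Dividing by \<open>t + 1\<close> rather than \<open>t\<close> covers
    \<open>t = 0\<close> and still gives \<open>t * \<delta> < \<epsilon>\<close>.\<close>
  define \<delta> where "\<delta> = \<epsilon> / (2 * (t + 1))"
  have \<delta>: "\<delta> > 0" using \<open>\<epsilon> > 0\<close> t by (simp add: \<delta>_def)
  have "uniformly_continuous_on {0..t} f"
    by (rule compact_uniformly_continuous[OF f compact_Icc])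
  then obtain d where d: "d > 0" and fd: "\<And>r s. r \<in> {0..t} \<Longrightarrow> s \<in> {0..t} \<Longrightarrow> dist s r < d \<Longrightarrow> dist (f s) (f r) < \<delta>"
    unfolding uniformly_continuous_on_def using \<delta> by metis
  obtain N :: nat where N: "N > 0" "t / real N < d"
  proof -
    obtain N where "t / d < real N" using reals_Archimedean2 by blast
    moreover have "t / d \<ge> 0" using t d by simp
    ultimately have "N > 0" by (simp add: Nat.gr0I)
    then have "t / real N < d" using d \<open>t / d < real N\<close> by (simp add: field_simps)
    with \<open>N > 0\<close> show ?thesis using that by blast
  qed
  show "\<exists>N. \<forall>n\<ge>N. norm ((\<Sum>k<n. (t / real n) *\<^sub>R f (real k * t / real n)) - (P t - P 0)) < \<epsilon>"
  proof (intro exI[of _ N] allI impI)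
    fix n assume n: "n \<ge> N"
    then have n0: "n > 0" using N by simp
    define \<tau> where "\<tau> k = real k * t / real n" for k :: nat
    have m: "t * real i \<le> t * real j" if "i \<le> j" for i j :: nat
      using that t by (intro mult_left_mono) auto
    have \<tau>: "\<tau> 0 = 0" "\<tau> n = t" "\<And>j. \<tau> j \<le> \<tau> (Suc j)" "\<And>j. j \<le> n \<Longrightarrow> \<tau> j \<in> {0..t}" "\<And>j. \<tau> (Suc j) - \<tau> j = t / real n"
      using n0 t by (auto simp: \<tau>_def divide_simps m algebra_simps)
    have "t / real n \<le> t / real N" using n N t by (auto intro!: divide_left_mono mult_pos_pos)
    then have tn: "t / real n < d" using N by simp
    \<comment> \<open>Mean value inequality on one cell: uniform continuity keeps the derivative of
      \<open>P\<close> within \<open>\<delta>\<close> of its value at the left endpoint.\<close>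
    have step: "norm (P (\<tau> (Suc k)) - P (\<tau> k) - (\<tau> (Suc k) - \<tau> k) *\<^sub>R f (\<tau> k)) \<le> norm (\<tau> (Suc k) - \<tau> k) * \<delta>" if "k < n" for k
    proof (rule vector_differentiable_bound_linearization[where S = "{\<tau> k..\<tau> (Suc k)}"])
      show "\<And>x. x \<in> {\<tau> k..\<tau> (Suc k)} \<Longrightarrow> (P has_vector_derivative f x) (at x within {\<tau> k..\<tau> (Suc k)})"
        by (rule has_vector_derivative_at_within[OF P])
      show "closed_segment (\<tau> k) (\<tau> (Suc k)) \<subseteq> {\<tau> k..\<tau> (Suc k)}"
        using \<tau>(3)[of k] by (simp add: closed_segment_eq_real_ivl)
      show "norm (f x - f (\<tau> k)) \<le> \<delta>" if x: "x \<in> {\<tau> k..\<tau> (Suc k)}" for x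
      proof -
        have "x \<in> {0..t}" using x \<tau>(4)[of k] \<tau>(4)[of "Suc k"] \<open>k < n\<close> by auto
        moreover have "dist x (\<tau> k) < d" using x \<tau>(5)[of k] tn by (auto simp: dist_real_def)
        ultimately show ?thesis using fd[of "\<tau> k" x] \<tau>(4)[of k] \<open>k < n\<close> by (auto simp: dist_norm intro: less_imp_le)
      qed
      show "\<tau> k \<in> {\<tau> k..\<tau> (Suc k)}" using \<tau>(3)[of k] by simp
    qed
    have "(\<Sum>k<n. P (\<tau> (Suc k)) - P (\<tau> k)) = P t - P 0"
      using sum_lessThan_telescope[of "\<lambda>k. P (\<tau> k)" n] by (simp add: \<tau>)
    then have "norm ((\<Sum>k<n. (t / real n) *\<^sub>R f (\<tau> k)) - (P t - P 0)) =
        norm (\<Sum>k<n. P (\<tau> (Suc k)) - P (\<tau> k) - (\<tau> (Suc k) - \<tau> k) *\<^sub>R f (\<tau> k))"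
      by (simp add: sum_subtractf \<tau>(5) norm_minus_commute)
    also have "\<dots> \<le> (\<Sum>k<n. norm (\<tau> (Suc k) - \<tau> k) * \<delta>)"
      by (rule sum_norm_le) (use step in auto)
    also have "\<dots> = t * \<delta>" using n0 t by (simp add: \<tau>(5))
    also have "\<dots> < \<epsilon>" using \<open>\<epsilon> > 0\<close> t by (simp add: \<delta>_def field_simps add_strict_increasing2)
    finally show "norm ((\<Sum>k<n. (t / real n) *\<^sub>R f (real k * t / real n)) - (P t - P 0)) < \<epsilon>"
      by (simp add: \<tau>_def)
  qed
qed

section \<open>Characteristic functions\<close>

lemma measurable_time_integral:
  fixes X :: "real \<Rightarrow> 'a \<Rightarrow> 'b::{banach, second_countable_topology}"
  assumes "(\<lambda>(t, \<omega>). X t \<omega>) \<in> borel_measurable (restrict_space borel {0..} \<Otimes>\<^sub>M M)"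
  shows "time_integral X t \<in> borel_measurable M"
proof -
  \<comment> \<open>Joint measurability is given for nonnegative times only; \<open>max 0\<close>
    extends the process to the whole line without changing it where the indicator is
    nonzero.\<close>
  have "(\<lambda>p :: 'a \<times> real. max 0 (snd p)) \<in> borel_measurable (M \<Otimes>\<^sub>M lborel)"
    by measurable
  then have "(\<lambda>p. (max 0 (snd p), fst p)) \<in> M \<Otimes>\<^sub>M lborel \<rightarrow>\<^sub>M restrict_space borel {0 :: real..} \<Otimes>\<^sub>M M"
    by (intro measurable_Pair measurable_restrict_space2) auto
  from measurable_compose[OF this assms]
  have [measurable]: "(\<lambda>p. X (max 0 (snd p)) (fst p)) \<in> borel_measurable (M \<Otimes>\<^sub>M lborel)"
    by simp
  have "(\<lambda>p. indicat_real {0..t} (snd p) *\<^sub>R X (max 0 (snd p)) (fst p)) \<in> borel_measurable (M \<Otimes>\<^sub>M lborel)"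
    by measurable
  then have "(\<lambda>(\<omega>, s). indicat_real {0..t} s *\<^sub>R X s \<omega>) \<in> borel_measurable (M \<Otimes>\<^sub>M lborel)"
    by (rule measurable_cong[THEN iffD1, rotated]) (auto split: split_indicator)
  from lborel.borel_measurable_lebesgue_integral[OF this]
  show ?thesis by (simp add: time_integral_def[abs_def] set_lebesgue_integral_def)
qed

lemma char_distr_affine:
  assumes "prob_space M" and [measurable]: "Y \<in> borel_measurable M"
  shows "char (distr M borel (\<lambda>\<omega>. d + c * Y \<omega>)) u = iexp (u * d) * char (distr M borel Y) (u * c)"
proof -
  interpret prob_space M by fact
  have "char (distr M borel (\<lambda>\<omega>. d + c * Y \<omega>)) u = (CLINT \<omega>|M. iexp (u * d) * iexp (u * c * Y \<omega>))"
    by (simp add: char_def integral_distr algebra_simps flip: exp_add)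
  then show ?thesis
    by (simp add: char_def integral_distr)
qed

text \<open>Independence factorises the characteristic function; stationarity replaces each
  increment by \<open>Z\<close> at the length of its cell, where the exponent is known.\<close>

lemma char_weighted_increments:
  assumes M: "prob_space M" and Z: "levy_process M Z" and \<Psi>: "characteristic_exponent M Z \<Psi>"
    and \<tau>: "0 \<le> \<tau> 0" "mono \<tau>"
  shows "char (distr M borel (\<lambda>\<omega>. \<Sum>k<n. c k * (Z (\<tau> (Suc k)) \<omega> - Z (\<tau> k) \<omega>))) u =
    exp (\<Sum>k<n. of_real (\<tau> (Suc k) - \<tau> k) * \<Psi> (u * c k))"
proof -
  interpret prob_space M by fact
  have pos: "0 \<le> \<tau> k" "\<tau> k \<le> \<tau> (Suc k)" for k
    using \<tau> by (auto intro: order_trans monoD)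
  have [measurable]: "Z s \<in> borel_measurable M" if "s \<ge> 0" for s
    using Z that by (simp add: levy_process_def)
  have mZ: "Z (\<tau> k) \<in> borel_measurable M" for k
    using pos by simp
  have inc: "(\<lambda>\<omega>. Z (\<tau> (Suc k)) \<omega> - Z (\<tau> k) \<omega>) \<in> borel_measurable M" for k
    by (intro borel_measurable_diff mZ)
  have "indep_vars (\<lambda>_. borel) (\<lambda>k \<omega>. Z (\<tau> (Suc k)) \<omega> - Z (\<tau> k) \<omega>) {..<n}"
    using Z \<tau> by (simp add: levy_process_def)
  then have "indep_vars (\<lambda>_. borel) (\<lambda>k \<omega>. c k * (Z (\<tau> (Suc k)) \<omega> - Z (\<tau> k) \<omega>)) {..<n}"
    by (rule indep_vars_compose2) measurable
  then have "char (distr M borel (\<lambda>\<omega>. \<Sum>k<n. c k * (Z (\<tau> (Suc k)) \<omega> - Z (\<tau> k) \<omega>))) u =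
      (\<Prod>k<n. char (distr M borel (\<lambda>\<omega>. c k * (Z (\<tau> (Suc k)) \<omega> - Z (\<tau> k) \<omega>))) u)"
    by (rule char_distr_sum)
  also have "\<dots> = (\<Prod>k<n. exp (of_real (\<tau> (Suc k) - \<tau> k) * \<Psi> (u * c k)))"
  proof (intro prod.cong refl)
    fix k
    have "distr M borel (\<lambda>\<omega>. Z (\<tau> k + (\<tau> (Suc k) - \<tau> k)) \<omega> - Z (\<tau> k) \<omega>) = distr M borel (Z (\<tau> (Suc k) - \<tau> k))"
      using Z pos[of k] unfolding levy_process_def by (metis diff_ge_0_iff_ge)
    then have "char (distr M borel (\<lambda>\<omega>. Z (\<tau> (Suc k)) \<omega> - Z (\<tau> k) \<omega>)) (u * c k) =
        exp (of_real (\<tau> (Suc k) - \<tau> k) * \<Psi> (u * c k))"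
      using \<Psi> pos[of k] by (simp add: characteristic_exponent_def)
    then show "char (distr M borel (\<lambda>\<omega>. c k * (Z (\<tau> (Suc k)) \<omega> - Z (\<tau> k) \<omega>))) u =
        exp (of_real (\<tau> (Suc k) - \<tau> k) * \<Psi> (u * c k))"
      using char_distr_affine[OF M inc, of 0 "c k" k u] by simp
  qed
  also have "\<dots> = exp (\<Sum>k<n. of_real (\<tau> (Suc k) - \<tau> k) * \<Psi> (u * c k))"
    by (simp add: exp_sum)
  finally show ?thesis .
qed

text \<open>Riemann-Stieltjes sum of the kernel against the time-changed driver, written as a
  functional of one path so that it composes with the path-valued variables of
  \<open>independent_processes\<close>.\<close>

definition ou_sum :: "real \<Rightarrow> real \<Rightarrow> nat \<Rightarrow> (real \<Rightarrow> real) \<Rightarrow> real" where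
  "ou_sum lam t n z = (\<Sum>k<n. (1 - exp (- lam * (t - real k * t / real n))) / lam *
     (z (lam * (real (Suc k) * t / real n)) - z (lam * (real k * t / real n))))"

text \<open>For nonzero \<open>lam\<close>, the integral over \<open>{0..t}\<close> of the pure
  decay \<open>x0 * exp (- lam * s)\<close>.\<close>

definition ou_initial :: "real \<Rightarrow> real \<Rightarrow> real \<Rightarrow> real" where
  "ou_initial lam x0 t = inverse lam * (1 - exp (- lam * t)) * x0"

lemma measurable_ou_sum:
  assumes "lam \<ge> 0" "t \<ge> 0"
  shows "ou_sum lam t n \<in> borel_measurable (\<Pi>\<^sub>M t\<in>{0..}. borel)"
proof -
  have "(\<lambda>z. z (lam * (real k * t / real n))) \<in> borel_measurable (\<Pi>\<^sub>M t\<in>{0..}. borel)" for k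
    using assms by (intro measurable_component_singleton) simp
  note [measurable] = this this[of "Suc _"]
  show ?thesis unfolding ou_sum_def[abs_def] by measurable
qed

text \<open>Independence is stated for paths restricted to nonnegative times; the sum reads no
  others.\<close>

lemma ou_sum_restrict:
  assumes "lam \<ge> 0" "t \<ge> 0"
  shows "ou_sum lam t n (\<lambda>s\<in>{0..}. z s) = ou_sum lam t n z"
  using assms by (simp add: ou_sum_def)

lemma ou_sum_tendsto:
  assumes lam: "lam > 0" and t: "t \<ge> 0"
    and Z: "subordinator M Z" and X: "ou_process M lam x0 Z X"
  shows "AE \<omega> in M. (\<lambda>n. ou_sum lam t n (\<lambda>s. Z s \<omega>)) \<longlonglongrightarrow> time_integral X t \<omega> - ou_initial lam x0 t"
proof -
  have "AE \<omega> in M. mono_on {0..} (\<lambda>t. Z t \<omega>)" "AE \<omega> in M. Z 0 \<omega> = 0"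
    "AE \<omega> in M. \<forall>t\<ge>0. set_integrable lborel {0..t} (\<lambda>s. X s \<omega>) \<and>
        X t \<omega> = x0 - lam * (LINT s:{0..t}|lborel. X s \<omega>) + Z (lam * t) \<omega>"
    using Z X by (auto simp: subordinator_def levy_process_def ou_process_def)
  then show ?thesis
  proof eventually_elim
    case (elim \<omega>)
    then show ?case
      unfolding ou_sum_def ou_initial_def time_integral_def
      by (intro ou_path_stieltjes_sum[OF lam t]) (use t in auto)
  qed
qed

text \<open>The characteristic functions are exponentials of left Riemann sums of \<open>f\<close>,
  whose primitive is known from \<open>ig_integral_derivative\<close>.\<close>

lemma char_ou_sum_tendsto:
  assumes M: "prob_space M" and lam: "lam > 0" and b: "b > 0" and t: "t \<ge> 0"
    and Z: "ig_subordinator M a b Z"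
  shows "(\<lambda>n. char (distr M borel (\<lambda>\<omega>. ou_sum lam t n (\<lambda>s. Z s \<omega>))) y) \<longlonglongrightarrow> exp (I_plus lam a b t y)"
proof -
  define f where "f r = of_real lam * ig_exponent a b (y * (1 - exp (- lam * (t - r))) / lam)" for r
  \<comment> \<open>The kernel depends on the remaining time \<open>t - r\<close>; reversing time
    and changing the sign gives a primitive of \<open>f\<close> with \<open>P t = 0\<close>.\<close>
  define P where "P r = - ig_integral lam a b y (t - r)" for r
  have P: "(P has_vector_derivative f r) (at r)" for r
  proof -
    have "((\<lambda>r. ig_integral lam a b y r) \<circ> (\<lambda>r. t - r) has_vector_derivative (- 1) *\<^sub>R f r) (at r)"
      unfolding f_def
      by (rule vector_diff_chain_at[OF _ ig_integral_derivative[OF lam b]])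
         (auto intro!: derivative_eq_intros)
    from has_vector_derivative_minus[OF this] show ?thesis
      by (simp add: P_def[abs_def] o_def)
  qed
  have f: "continuous_on {0..t} f"
  proof (intro continuous_at_imp_continuous_on ballI)
    fix r
    have "Re (- 2 * \<i> * of_real (y * (1 - exp (- lam * (t - r))) / lam) + (of_real b)\<^sup>2) > 0"
      using b by (simp flip: of_real_power)
    then have "- 2 * \<i> * of_real (y * (1 - exp (- lam * (t - r))) / lam) + (of_real b)\<^sup>2 \<notin> \<real>\<^sub>\<le>\<^sub>0"
      by (metis complex_nonpos_Reals_iff not_le)
    then show "isCont f r"
      unfolding f_def ig_exponent_def using lam by (intro continuous_intros isCont_csqrt') auto
  qed
  have "(\<lambda>n::nat. \<Sum>k<n. (t / real n) *\<^sub>R f (real k * t / real n)) \<longlonglongrightarrow> P t - P 0"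
    by (rule riemann_sum_tendsto[OF t P f])
  also have "P t - P 0 = I_plus lam a b t y"
    by (simp add: P_def ig_integral_0[OF lam b] I_plus_eq[OF lam b])
  finally have "(\<lambda>n. exp (\<Sum>k<n. (t / real n) *\<^sub>R f (real k * t / real n))) \<longlonglongrightarrow> exp (I_plus lam a b t y)"
    by (rule tendsto_exp)
  moreover have "char (distr M borel (\<lambda>\<omega>. ou_sum lam t n (\<lambda>s. Z s \<omega>))) y = exp (\<Sum>k<n. (t / real n) *\<^sub>R f (real k * t / real n))" for n
  proof -
    \<comment> \<open>The driver runs at speed \<open>lam\<close>: each cell has length
      \<open>lam * t / n\<close>, which supplies the factor \<open>lam\<close> in
      \<open>f\<close>.\<close>
    define \<tau> where "\<tau> k = lam * (real k * t / real n)" for k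
    have \<tau>: "0 \<le> \<tau> 0" "mono \<tau>"
      using lam t by (auto simp: \<tau>_def mono_def intro!: mult_left_mono divide_right_mono mult_right_mono)
    have "\<tau> (Suc k) - \<tau> k = lam * (t / real n)" for k
      by (simp add: \<tau>_def algebra_simps add_divide_distrib)
    then show ?thesis
      using char_weighted_increments[OF M _ _ \<tau>, where Z = Z and \<Psi> = "ig_exponent a b" and n = n
          and c = "\<lambda>k. (1 - exp (- lam * (t - real k * t / real n))) / lam" and u = y] Z
      by (simp add: ou_sum_def \<tau>_def ig_subordinator_def subordinator_def f_def scaleR_conv_of_real mult_ac)
  qed
  ultimately show ?thesis by simp
qed

text \<open>The integrals are reached only as almost sure limits of functionals of the driver paths.
  Independence is therefore used at each fixed \<open>n\<close>, and both sides pass to the limit: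
  the factors by \<open>char_ou_sum_tendsto\<close>, the joint expectation by dominated
  convergence.\<close>

lemma joint_char_time_integral:
  fixes Z X :: "'i \<Rightarrow> real \<Rightarrow> 'a \<Rightarrow> real"
  assumes M: "prob_space M" and t: "t \<ge> 0" and I: "finite I"
    and indep: "independent_processes M I Z"
    and Z: "\<And>i. i \<in> I \<Longrightarrow> ig_subordinator M (a i) (b i) (Z i)"
    and X: "\<And>i. i \<in> I \<Longrightarrow> ou_process M (lam i) (x0 i) (Z i) (X i)"
    and lam: "\<And>i. i \<in> I \<Longrightarrow> lam i > 0" and b: "\<And>i. i \<in> I \<Longrightarrow> b i > 0"
  shows "(CLINT \<omega>|M. iexp (\<Sum>i\<in>I. y i * time_integral (X i) t \<omega>)) =
    (\<Prod>i\<in>I. iexp (y i * ou_initial (lam i) (x0 i) t) * exp (I_plus (lam i) (a i) (b i) t (y i)))"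
proof -
  interpret prob_space M by fact
  define W where "W n i \<omega> = y i * ou_initial (lam i) (x0 i) t + y i * ou_sum (lam i) t n (\<lambda>s. Z i s \<omega>)" for n i \<omega>
  have indepW: "indep_vars (\<lambda>_. borel) (W n) I" for n
  proof -
    have "indep_vars (\<lambda>_. borel) (\<lambda>i \<omega>. y i * ou_initial (lam i) (x0 i) t + y i * ou_sum (lam i) t n (\<lambda>s\<in>{0..}. Z i s \<omega>)) I"
      by (rule indep_vars_compose2[OF indep[unfolded independent_processes_def]])
         (use lam t in \<open>auto intro!: borel_measurable_add borel_measurable_times measurable_ou_sum less_imp_le\<close>)
    then show ?thesis
      by (rule indep_vars_cong[THEN iffD1, rotated -1]) (use lam t in \<open>auto simp: W_def fun_eq_iff ou_sum_restrict less_imp_le\<close>)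
  qed
  have mW: "W n i \<in> borel_measurable M" if "i \<in> I" for n i
    using indepW[of n] that by (simp add: indep_vars_def)
  have char_sum: "(CLINT \<omega>|M. iexp (\<Sum>i\<in>I. W n i \<omega>)) =
      (\<Prod>i\<in>I. iexp (y i * ou_initial (lam i) (x0 i) t) *
        char (distr M borel (\<lambda>\<omega>. ou_sum (lam i) t n (\<lambda>s. Z i s \<omega>))) (y i))" for n
  proof -
    \<comment> \<open>The evaluation point is 1 because the weights \<open>y i\<close> are already
      part of \<open>W\<close>.\<close>
    have "(CLINT \<omega>|M. iexp (\<Sum>i\<in>I. W n i \<omega>)) = char (distr M borel (\<lambda>\<omega>. \<Sum>i\<in>I. W n i \<omega>)) 1"
      using mW by (simp add: char_def integral_distr)
    also have "\<dots> = (\<Prod>i\<in>I. char (distr M borel (W n i)) 1)"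
      by (rule char_distr_sum[OF indepW])
    also have "\<dots> = (\<Prod>i\<in>I. iexp (y i * ou_initial (lam i) (x0 i) t) *
        char (distr M borel (\<lambda>\<omega>. ou_sum (lam i) t n (\<lambda>s. Z i s \<omega>))) (y i))"
    proof (intro prod.cong refl)
      fix i assume i: "i \<in> I"
      have "Z i s \<in> borel_measurable M" if "s \<ge> 0" for s
        using Z[OF i] that by (simp add: ig_subordinator_def subordinator_def levy_process_def)
      then have "(\<lambda>\<omega>. ou_sum (lam i) t n (\<lambda>s. Z i s \<omega>)) \<in> borel_measurable M"
        unfolding ou_sum_def using lam[OF i] t
        by (intro borel_measurable_sum borel_measurable_times borel_measurable_diff borel_measurable_const) auto
      from char_distr_affine[OF M this, of _ _ 1]
      show "char (distr M borel (W n i)) 1 = iexp (y i * ou_initial (lam i) (x0 i) t) *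
        char (distr M borel (\<lambda>\<omega>. ou_sum (lam i) t n (\<lambda>s. Z i s \<omega>))) (y i)"
        by (simp add: W_def[abs_def])
    qed
    finally show ?thesis .
  qed
  have "(\<lambda>n. CLINT \<omega>|M. iexp (\<Sum>i\<in>I. W n i \<omega>)) \<longlonglongrightarrow>
      (\<Prod>i\<in>I. iexp (y i * ou_initial (lam i) (x0 i) t) * exp (I_plus (lam i) (a i) (b i) t (y i)))"
    unfolding char_sum
    by (intro tendsto_prod tendsto_mult tendsto_const char_ou_sum_tendsto M t lam b Z)
  moreover have "(\<lambda>n. CLINT \<omega>|M. iexp (\<Sum>i\<in>I. W n i \<omega>)) \<longlonglongrightarrow>
      (CLINT \<omega>|M. iexp (\<Sum>i\<in>I. y i * time_integral (X i) t \<omega>))"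
  proof (rule integral_dominated_convergence[where w = "\<lambda>_. 1"])
    have [measurable]: "time_integral (X i) t \<in> borel_measurable M" if "i \<in> I" for i
      using X[OF that] by (intro measurable_time_integral) (simp add: ou_process_def)
    show "(\<lambda>\<omega>. iexp (\<Sum>i\<in>I. y i * time_integral (X i) t \<omega>)) \<in> borel_measurable M"
      by measurable
    show "(\<lambda>\<omega>. iexp (\<Sum>i\<in>I. W n i \<omega>)) \<in> borel_measurable M" for n
      using mW by measurable
    have "AE \<omega> in M. \<forall>i\<in>I. (\<lambda>n. ou_sum (lam i) t n (\<lambda>s. Z i s \<omega>)) \<longlonglongrightarrow>
        time_integral (X i) t \<omega> - ou_initial (lam i) (x0 i) t"
      using I ou_sum_tendsto[OF lam t _ X] Z by (auto simp: AE_ball_countable[OF countable_finite] ig_subordinator_def)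
    then show "AE \<omega> in M. (\<lambda>n. iexp (\<Sum>i\<in>I. W n i \<omega>)) \<longlonglongrightarrow> iexp (\<Sum>i\<in>I. y i * time_integral (X i) t \<omega>)"
    proof eventually_elim
      case (elim \<omega>)
      have "(\<lambda>n. W n i \<omega>) \<longlonglongrightarrow> y i * time_integral (X i) t \<omega>" if "i \<in> I" for i
      proof -
        have "(\<lambda>n. W n i \<omega>) \<longlonglongrightarrow> y i * ou_initial (lam i) (x0 i) t +
            y i * (time_integral (X i) t \<omega> - ou_initial (lam i) (x0 i) t)"
          unfolding W_def using elim that by (intro tendsto_intros) auto
        then show ?thesis by (simp add: algebra_simps)
      qed
      then show ?case
        by (intro tendsto_exp tendsto_mult tendsto_const tendsto_of_real tendsto_sum)
    qed
  qed auto
  ultimately show ?thesis by (rule LIMSEQ_unique[rotated])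
qed

section \<open>The covariance matrix\<close>

text \<open>Both terms are linear in their vector, and \<open>diag_matrix\<close> sends the
  \<open>l\<close>-th basis vector to \<open>unit_matrix l\<close>. Scalar coefficients of constant
  matrices serve both the trace and the measurability of the covariance.\<close>

lemma diag_conjugate_eq_sum:
  fixes A :: "real^'n^'n"
  shows "diag_matrix f + A ** diag_matrix v ** transpose A =
    (\<Sum>l\<in>UNIV. f $ l *\<^sub>R unit_matrix l) + (\<Sum>l\<in>UNIV. v $ l *\<^sub>R (A ** unit_matrix l ** transpose A))"
proof -
  have u: "diag_matrix (axis l 1 :: real^'n) = unit_matrix l" for l
    by (auto simp: vec_eq_iff diag_matrix_def unit_matrix_def axis_def)
  have e: "(\<Sum>l\<in>UNIV. w $ l *\<^sub>R axis l 1) = w" for w :: "real^'n"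
    using basis_expansion[of w] by (simp add: scalar_mult_eq_scaleR)
  have "L w = (\<Sum>l\<in>UNIV. w $ l *\<^sub>R L (axis l 1))" if "linear L" for L :: "real^'n \<Rightarrow> real^'n^'n" and w
    using linear_sum[OF that, of "\<lambda>l. w $ l *\<^sub>R axis l 1" UNIV] by (simp add: e linear_scale[OF that])
  from this[OF linear_diag_matrix, of f] this[OF linear_conjugate_diag_matrix[of A], of v]
  show ?thesis by (simp add: u)
qed

lemma linear_trace_mult: "linear (\<lambda>M :: real^'n^'n. trace (\<theta> ** M))"
  by (rule linearI)
     (simp_all add: trace_def matrix_matrix_mult_def sum.distrib sum_distrib_left algebra_simps)

lemma trace_mult_unit_matrix: "trace (\<theta> ** unit_matrix l) = \<theta> $ l $ l" for \<theta> :: "real^'n^'n"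
proof -
  have "(\<Sum>k\<in>UNIV. \<theta> $ i $ k * (if k = l \<and> i = l then 1 else 0)) = (if i = l then \<theta> $ i $ l else 0)" for i
    by (cases "i = l") (simp_all add: if_distrib cong: if_cong)
  then show ?thesis
    by (simp add: trace_def matrix_matrix_mult_def unit_matrix_def)
qed

text \<open>Reduces the matrix argument to a scalar linear combination of the factors, with exactly
  the weights found in \<open>K1_plus\<close> and \<open>K2_plus\<close>.\<close>

lemma trace_diag_conjugate:
  fixes A \<theta> :: "real^'n^'n"
  shows "trace (\<theta> ** (diag_matrix f + A ** diag_matrix v ** transpose A)) =
    (\<Sum>l\<in>UNIV. \<theta> $ l $ l * f $ l) + (\<Sum>l\<in>UNIV. trace (\<theta> ** A ** unit_matrix l ** transpose A) * v $ l)"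
  unfolding diag_conjugate_eq_sum
  by (simp only: linear_add[OF linear_trace_mult] linear_sum[OF linear_trace_mult] linear_scale[OF linear_trace_mult])
     (simp add: trace_mult_unit_matrix matrix_mul_assoc mult.commute)

theorem theorem3p1:
  fixes Q :: "'a measure"
    and ZF ZV :: "2 \<Rightarrow> real \<Rightarrow> 'a \<Rightarrow> real"
    and F V :: "real \<Rightarrow> 'a \<Rightarrow> real^2"
    and lamF lamV aF bF aV bV f0 v0 :: "real^2"
    and A \<theta> :: "real^2^2"
    and t :: real
  assumes Q: "prob_space Q"
    and params_F: "\<And>l. lamF $ l > 0" "\<And>l. aF $ l > 0" "\<And>l. bF $ l > 0"
    and params_V: "\<And>l. lamV $ l > 0" "\<And>l. aV $ l > 0" "\<And>l. bV $ l > 0"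
    and ZF: "\<And>l. ig_subordinator Q (aF $ l) (bF $ l) (ZF l)"
    and ZV: "\<And>l. ig_subordinator Q (aV $ l) (bV $ l) (ZV l)"
    and indep: "independent_processes Q (UNIV :: (2 + 2) set) (case_sum ZF ZV)"
    and F: "\<And>l. ou_process Q (lamF $ l) (f0 $ l) (ZF l) (\<lambda>s \<omega>. F s \<omega> $ l)"
    and V: "\<And>l. ou_process Q (lamV $ l) (v0 $ l) (ZV l) (\<lambda>s \<omega>. V s \<omega> $ l)"
    and A: "orthogonal_matrix A"
    and t: "t \<ge> 0"
    and theta: "\<theta> \<noteq> 0"
  shows "matrix_char Q (integrated_covariance A F V t) \<theta> =
    exp (K1_plus lamF aF bF f0 t \<theta> + K2_plus A lamV aV bV v0 t \<theta>)"
proof -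
  interpret prob_space Q by (rule Q)
  \<comment> \<open>The four factors become one family over the sum type \<open>2 + 2\<close>, on
    which the independence of the drivers is stated.\<close>
  define X where "X = case_sum (\<lambda>l s \<omega>. F s \<omega> $ l) (\<lambda>l s \<omega>. V s \<omega> $ l)"
  define y where "y = case_sum (\<lambda>l. \<theta> $ l $ l) (\<lambda>l. trace (\<theta> ** A ** unit_matrix l ** transpose A))"
  define lam where "lam = case_sum (($) lamF) (($) lamV)"
  define a where "a = case_sum (($) aF) (($) aV)"
  define b where "b = case_sum (($) bF) (($) bV)"
  define x0 where "x0 = case_sum (($) f0) (($) v0)"
  note defs = X_def y_def lam_def a_def b_def x0_def
  have sum2: "(\<Sum>i\<in>UNIV. g i) = (\<Sum>l\<in>UNIV. g (Inl l)) + (\<Sum>l\<in>UNIV. g (Inr l))"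
    for g :: "2 + 2 \<Rightarrow> 'c::comm_monoid_add"
    using sum.Plus[of "UNIV :: 2 set" "UNIV :: 2 set" g] by (simp add: o_def)
  have X: "ou_process Q (lam i) (x0 i) (case_sum ZF ZV i) (X i)" for i
    using F V by (cases i) (simp_all add: defs)
  have joint: "(CLINT \<omega>|Q. iexp (\<Sum>i\<in>UNIV. y i * time_integral (X i) t \<omega>)) =
    (\<Prod>i\<in>UNIV. iexp (y i * ou_initial (lam i) (x0 i) t) * exp (I_plus (lam i) (a i) (b i) t (y i)))"
  proof (rule joint_char_time_integral[OF Q t _ indep _ X])
    fix i show "ig_subordinator Q (a i) (b i) (case_sum ZF ZV i)" "lam i > 0" "b i > 0"
      using ZF ZV params_F params_V by (cases i; simp add: defs)+
  qed simp
  have trace_measurable: "(\<lambda>M. trace (\<theta> ** M)) \<in> borel_measurable borel"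
    by (intro borel_measurable_continuous_onI linear_continuous_on linear_trace_mult[THEN linear_conv_bounded_linear[THEN iffD1]])
  have "(\<lambda>(t, \<omega>). covariance A F V t \<omega>) \<in> borel_measurable (restrict_space borel {0..} \<Otimes>\<^sub>M Q)"
  proof -
    have [measurable]: "(\<lambda>p. F (fst p) (snd p) $ l) \<in> borel_measurable (restrict_space borel {0..} \<Otimes>\<^sub>M Q)"
      "(\<lambda>p. V (fst p) (snd p) $ l) \<in> borel_measurable (restrict_space borel {0..} \<Otimes>\<^sub>M Q)" for l
      using F[of l] V[of l] by (simp_all add: ou_process_def case_prod_beta')
    show ?thesis
      unfolding covariance_def diag_conjugate_eq_sum case_prod_beta' by measurable
  qed
  from measurable_time_integral[OF this, of t]
  have "integrated_covariance A F V t \<in> borel_measurable Q"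
    by (simp add: integrated_covariance_def)
  from measurable_compose[OF this trace_measurable]
  have [measurable]: "(\<lambda>\<omega>. trace (\<theta> ** integrated_covariance A F V t \<omega>)) \<in> borel_measurable Q" .
  have [measurable]: "time_integral (X i) t \<in> borel_measurable Q" for i
    using X[of i] by (intro measurable_time_integral) (simp add: ou_process_def)
  have "matrix_char Q (integrated_covariance A F V t) \<theta> =
      (CLINT \<omega>|Q. iexp (\<Sum>i\<in>UNIV. y i * time_integral (X i) t \<omega>))"
    unfolding matrix_char_def
  \<comment> \<open>Equality is only almost sure: the time integral commutes with the linear maps on
    paths whose components are integrable.\<close>
  proof (rule integral_cong_AE)
    have "AE \<omega> in Q. \<forall>l. set_integrable lborel {0..t} (\<lambda>s. F s \<omega> $ l) \<and> set_integrable lborel {0..t} (\<lambda>s. V s \<omega> $ l)"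
      unfolding AE_all_countable
    proof
      fix l
      have "AE \<omega> in Q. \<forall>t\<ge>0. set_integrable lborel {0..t} (\<lambda>s. F s \<omega> $ l)"
        using F[of l] unfolding ou_process_def by (auto elim: eventually_mono)
      moreover have "AE \<omega> in Q. \<forall>t\<ge>0. set_integrable lborel {0..t} (\<lambda>s. V s \<omega> $ l)"
        using V[of l] unfolding ou_process_def by (auto elim: eventually_mono)
      ultimately show "AE \<omega> in Q. set_integrable lborel {0..t} (\<lambda>s. F s \<omega> $ l) \<and> set_integrable lborel {0..t} (\<lambda>s. V s \<omega> $ l)"
        by eventually_elim (use t in auto)
    qed
    then show "AE \<omega> in Q. iexp (trace (\<theta> ** integrated_covariance A F V t \<omega>)) =
        iexp (\<Sum>i\<in>UNIV. y i * time_integral (X i) t \<omega>)"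
    proof eventually_elim
      case (elim \<omega>)
      have nth: "time_integral Y t \<omega> $ l = time_integral (\<lambda>s \<omega>. Y s \<omega> $ l) t \<omega>"
        if "\<And>l. set_integrable lborel {0..t} (\<lambda>s. Y s \<omega> $ l)" for Y :: "real \<Rightarrow> 'a \<Rightarrow> real^2" and l
        using time_integral_linear(2)[where X = Y and \<omega> = \<omega> and L = "\<lambda>v. v $ l",
            OF _ set_integrable_vec[where f = "\<lambda>s. Y s \<omega>", OF that]]
        by (simp add: bounded_linear.linear bounded_linear_vec_nth)
      have "integrated_covariance A F V t \<omega> =
          diag_matrix (time_integral F t \<omega>) + A ** diag_matrix (time_integral V t \<omega>) ** transpose A"
        using elim by (intro integrated_covariance_eq) auto
      then have "trace (\<theta> ** integrated_covariance A F V t \<omega>) = (\<Sum>i\<in>UNIV. y i * time_integral (X i) t \<omega>)"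
        using elim by (simp add: trace_diag_conjugate sum2 defs nth)
      then show ?case by simp
    qed
  qed measurable
  also have "\<dots> = exp (\<Sum>i\<in>UNIV. \<i> * of_real (y i * ou_initial (lam i) (x0 i) t) + I_plus (lam i) (a i) (b i) t (y i))"
    unfolding joint by (simp add: exp_sum exp_add)
  also have "(\<Sum>i\<in>UNIV. \<i> * of_real (y i * ou_initial (lam i) (x0 i) t) + I_plus (lam i) (a i) (b i) t (y i)) =
      K1_plus lamF aF bF f0 t \<theta> + K2_plus A lamV aV bV v0 t \<theta>"
    by (simp add: sum2 defs K1_plus_def K2_plus_def ou_initial_def sum.distrib sum_distrib_left mult.assoc)
  finally show ?thesis .
qed

end
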